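(* Let $n\ge 1$, $d\ge 1$, let $k_1,\dots,k_d\ge 1$ be integers, and let $F_1,\dots,F_d:\mathbb{R}^n\to\mathbb{R}$ be polynomials such that $F_i\in \mathrm{Ker}(\mathcal{L}+k_i I)$ for $i=1,\dots,d$. Then $$\int_{\mathbb{R}^n}\left(\prod_{i=1}^d F_i^2\right)d\gamma_n\ \ge\ \prod_{i=1}^d\int_{\mathbb{R}^n}F_i^2\,d\gamma_n,$$ with equality if and only if $F_1,\dots,F_d$ are jointly independent (as random variables on the probability space $(\mathbb{R}^n,\mathcal{B}(\mathbb{R}^n),\gamma_n)$).
   Context: $\gamma_n$ is the standard Gaussian measure on $\mathbb{R}^n$, $d\gamma_n(x)=(2\pi)^{-n/2}e^{-\|x\|^2/2}dx$. $\mathcal{L}$ is the generator of the Ornstein-Uhlenbeck semigroup on $\mathbb{R}^n$: $\mathcal{L}f=\Delta f-\langle x,\nabla f\rangle=\sum_{i=1}^n\frac{\partial^2 f}{\partial x_i^2}-\sum_{i=1}^n x_i\frac{\partial f}{\partial x_i}$. $I$ is the identity operator. The Hermite polynomials on the real line are defined by $H_0\equiv 1$, $H_{k+1}(x)=xH_k(x)-H_k'(x)$. The space $\mathrm{Ker}(\mathcal{L}+kI)$ (the $k$th Wiener chaos associated with $\gamma_n$) is the space of polynomials of the form $F(x_1,\dots,x_n)=\sum_{i_1+\cdots+i_n=k}\alpha(i_1,\dots,i_n)\prod_{j=1}^n H_{i_j}(x_j)$ with real coefficients $\alpha(i_1,\dots,i_n)$.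
   Formalization: "Equality implies joint independence" is stated only when d ≤ 2 or no F_i is identically zero; as written it fails for d ≥ 3, e.g. n=1, F_1=0, F_2=F_3=H_1, where both sides are 0 but F_2, F_3 are dependent. *)

theory Defs
  imports "HOL-Probability.Probability" "HOL-Computational_Algebra.Polynomial"
begin

section \<open>The standard Gaussian measure\<close>

definition gauss_measure :: "(real ^ 'n) measure" where
  "gauss_measure = density lborel
     (\<lambda>x. ennreal ((2 * pi) powr (- real CARD('n) / 2) * exp (- (norm x)\<^sup>2 / 2)))"

lemma sets_gauss_measure [measurable_cong, simp]: "sets gauss_measure = sets borel"
  by (simp add: gauss_measure_def)

lemma space_gauss_measure [simp]: "space gauss_measure = UNIV"
  by (simp add: gauss_measure_def)

lemma gauss_density_prod:
  fixes x :: "real ^ 'n"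
  shows "(2 * pi) powr (- real CARD('n) / 2) * exp (- (norm x)\<^sup>2 / 2)
           = (\<Prod>b\<in>Basis. std_normal_density (x \<bullet> b))"
proof -
  have "(\<Prod>b\<in>Basis. std_normal_density (x \<bullet> b))
      = (\<Prod>b\<in>(Basis::(real^'n) set). 1 / sqrt (2 * pi)) * (\<Prod>b\<in>Basis. exp (- (x \<bullet> b)\<^sup>2 / 2))"
    unfolding std_normal_density_def by (rule prod.distrib)
  also have "(\<Prod>b\<in>Basis. exp (- (x \<bullet> b)\<^sup>2 / 2)) = exp (\<Sum>b\<in>Basis. - (x \<bullet> b)\<^sup>2 / 2)"
    by (simp add: exp_sum)
  also have "(\<Sum>b\<in>Basis. - (x \<bullet> b)\<^sup>2 / 2) = - (norm x)\<^sup>2 / 2"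
    by (subst power2_norm_eq_inner, subst euclidean_inner)
       (simp add: power2_eq_square sum_negf flip: sum_divide_distrib)
  also have "(\<Prod>b\<in>(Basis::(real^'n) set). 1 / sqrt (2 * pi)) = (2 * pi) powr (- real CARD('n) / 2)"
  proof -
    have "1 / sqrt (2 * pi) = (2 * pi) powr (- 1 / 2)"
      by (simp add: powr_half_sqrt powr_minus_divide)
    then have "(\<Prod>b\<in>(Basis::(real^'n) set). 1 / sqrt (2 * pi)) = ((2 * pi) powr (- 1 / 2)) ^ CARD('n)"
      by simp
    also have "\<dots> = (2 * pi) powr (- real CARD('n) / 2)"
      by (simp add: powr_powr flip: powr_realpow)
    finally show ?thesis .
  qed
  finally show ?thesis by simp
qed

lemma prob_space_gauss_measure: "prob_space (gauss_measure :: (real ^ 'n) measure)"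
proof
  have n: "(\<integral>\<^sup>+ y. ennreal (std_normal_density y) \<partial>lborel) = 1"
    using prob_space.emeasure_space_1[OF prob_space_normal_density[of 1 0]]
    by (simp add: emeasure_density)
  have "emeasure (gauss_measure :: (real ^ 'n) measure) (space gauss_measure)
      = (\<integral>\<^sup>+ x. (\<Prod>b\<in>Basis. ennreal (std_normal_density (x \<bullet> b))) \<partial>(lborel :: (real ^ 'n) measure))"
    unfolding gauss_measure_def gauss_density_prod by (simp add: emeasure_density prod_ennreal)
  also have "\<dots> = 1"
    by (subst nn_integral_lborel_prod) (simp_all add: n)
  finally show "emeasure (gauss_measure :: (real ^ 'n) measure) (space gauss_measure) = 1" .
qed

section \<open>The Ornstein--Uhlenbeck generator and the Wiener chaoses\<close>

definition partial_deriv :: "'n \<Rightarrow> (real ^ 'n \<Rightarrow> real) \<Rightarrow> real ^ 'n \<Rightarrow> real" where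
  "partial_deriv i f x = deriv (\<lambda>t. f (x + t *\<^sub>R axis i 1)) 0"

definition ou_generator :: "(real ^ 'n \<Rightarrow> real) \<Rightarrow> real ^ 'n \<Rightarrow> real" where
  "ou_generator f x = (\<Sum>i\<in>UNIV. partial_deriv i (partial_deriv i f) x) - (\<Sum>i\<in>UNIV. x $ i * partial_deriv i f x)"

text \<open>The operator is considered on polynomials, so \<open>wiener_chaos k\<close> is the kernel of
  \<open>L + k I\<close> there. The lemma \<open>wiener_chaos_eq_hermite\<close> below shows that it consists exactly
  of the sums of products of Hermite polynomials of total degree \<open>k\<close>.\<close>

definition wiener_chaos :: "nat \<Rightarrow> (real ^ 'n \<Rightarrow> real) set" where
  "wiener_chaos k = {F. real_polynomial_function F \<and> (\<forall>x. ou_generator F x + real k * F x = 0)}"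

subsection \<open>Hermite polynomials\<close>

primrec hermite :: "nat \<Rightarrow> real poly" where
  "hermite 0 = 1"
| "hermite (Suc k) = [:0, 1:] * hermite k - pderiv (hermite k)"

definition hermite_prod :: "('n \<Rightarrow> nat) \<Rightarrow> real ^ 'n \<Rightarrow> real" where
  "hermite_prod a x = (\<Prod>j\<in>UNIV. poly (hermite (a j)) (x $ j))"

definition hermite_chaos :: "nat \<Rightarrow> (real ^ 'n \<Rightarrow> real) set" where
  "hermite_chaos k = {F. \<exists>\<alpha>. F = (\<lambda>x. \<Sum>a | (\<Sum>j\<in>UNIV. a j) = k. \<alpha> a * hermite_prod a x)}"

lemma hermite_ode:
  "pderiv (hermite (Suc k)) = of_nat (Suc k) * hermite k \<and>
   pderiv (pderiv (hermite k)) - [:0, 1:] * pderiv (hermite k) = - (of_nat k * hermite k)"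
proof (induction k)
  case 0
  show ?case by (simp add: pderiv_pCons)
next
  case (Suc k)
  let ?h = "hermite k" and ?g = "hermite (Suc k)"
  have D: "pderiv ?g = of_nat (Suc k) * ?h" using Suc by blast
  have pd: "pderiv (of_nat (Suc k) * p) = of_nat (Suc k) * pderiv p" for p :: "real poly"
    by (simp only: of_nat_poly pderiv_smult mult_pCons_left) (simp add: pderiv_smult)
  have "pderiv (pderiv ?g) - [:0, 1:] * pderiv ?g
      = of_nat (Suc k) * (pderiv ?h - [:0, 1:] * ?h)"
    unfolding D pd by (simp only: algebra_simps)
  also have "\<dots> = - (of_nat (Suc k) * ?g)"
    unfolding hermite.simps by (simp only: algebra_simps)
  finally have O: "pderiv (pderiv ?g) - [:0, 1:] * pderiv ?g = - (of_nat (Suc k) * ?g)" .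
  have x: "pderiv [:0, 1::real:] = 1" by (simp add: pderiv_pCons)
  have "pderiv (hermite (Suc (Suc k))) = ?g - (pderiv (pderiv ?g) - [:0, 1:] * pderiv ?g)"
    unfolding hermite.simps(2)[of "Suc k"] pderiv_diff pderiv_mult x
    by (simp only: algebra_simps mult_1_right)
  also have "\<dots> = of_nat (Suc (Suc k)) * ?g"
    unfolding O by (simp add: algebra_simps)
  finally show ?case using O by blast
qed

lemma finite_multi_indices: "finite {a :: 'n::finite \<Rightarrow> nat. (\<Sum>j\<in>UNIV. a j) = k}"
proof (rule finite_subset)
  show "{a :: 'n \<Rightarrow> nat. (\<Sum>j\<in>UNIV. a j) = k} \<subseteq> PiE UNIV (\<lambda>_. {..k})"
    by (auto intro: member_le_sum)
  show "finite (PiE (UNIV :: 'n set) (\<lambda>_. {..k}))"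
    by (intro finite_PiE) auto
qed

subsection \<open>The kernel on polynomials is the Hermite chaos\<close>

definition has_partial :: "'n \<Rightarrow> (real ^ 'n \<Rightarrow> real) \<Rightarrow> (real ^ 'n \<Rightarrow> real) \<Rightarrow> bool" where
  "has_partial i f g \<longleftrightarrow>
     (\<forall>x. ((\<lambda>t. f (x + t *\<^sub>R axis i 1)) has_field_derivative g x) (at 0))"

definition has_ou :: "(real ^ 'n \<Rightarrow> real) \<Rightarrow> (real ^ 'n \<Rightarrow> real) \<Rightarrow> bool" where
  "has_ou f g \<longleftrightarrow> (\<exists>f1 f2. (\<forall>i. has_partial i f (f1 i) \<and> has_partial i (f1 i) (f2 i)) \<and>
      g = (\<lambda>x. (\<Sum>i\<in>UNIV. f2 i x) - (\<Sum>i\<in>UNIV. x $ i * f1 i x)))"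

lemma has_partial_imp: "has_partial i f g \<Longrightarrow> partial_deriv i f = g"
  unfolding has_partial_def partial_deriv_def by (auto intro!: ext DERIV_imp_deriv)

lemma has_ou_imp: "has_ou f g \<Longrightarrow> ou_generator f = g"
proof -
  assume "has_ou f g"
  then obtain f1 f2 where
    f: "\<And>i. has_partial i f (f1 i)" "\<And>i. has_partial i (f1 i) (f2 i)"
       "g = (\<lambda>x. (\<Sum>i\<in>UNIV. f2 i x) - (\<Sum>i\<in>UNIV. x $ i * f1 i x))"
    unfolding has_ou_def by blast
  show ?thesis
    by (rule ext) (simp add: ou_generator_def f(3) has_partial_imp[OF f(1)] has_partial_imp[OF f(2)])
qed

lemma has_ou_0: "has_ou (\<lambda>x. 0) (\<lambda>x. 0)"
  unfolding has_ou_def has_partial_def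
  by (rule exI[of _ "\<lambda>i x. 0"], rule exI[of _ "\<lambda>i x. 0"]) auto

lemma has_ou_add:
  assumes "has_ou f g" "has_ou f' g'"
  shows "has_ou (\<lambda>x. f x + f' x) (\<lambda>x. g x + g' x)"
proof -
  from assms(1) obtain f1 f2 where
    f: "\<And>i. has_partial i f (f1 i)" "\<And>i. has_partial i (f1 i) (f2 i)"
       "g = (\<lambda>x. (\<Sum>i\<in>UNIV. f2 i x) - (\<Sum>i\<in>UNIV. x $ i * f1 i x))"
    unfolding has_ou_def by blast
  from assms(2) obtain e1 e2 where
    e: "\<And>i. has_partial i f' (e1 i)" "\<And>i. has_partial i (e1 i) (e2 i)"
       "g' = (\<lambda>x. (\<Sum>i\<in>UNIV. e2 i x) - (\<Sum>i\<in>UNIV. x $ i * e1 i x))"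
    unfolding has_ou_def by blast
  have p: "has_partial i (\<lambda>x. f x + f' x) (\<lambda>x. f1 i x + e1 i x)"
          "has_partial i (\<lambda>x. f1 i x + e1 i x) (\<lambda>x. f2 i x + e2 i x)" for i
    using f(1,2)[of i] e(1,2)[of i] unfolding has_partial_def by (auto simp only: intro!: DERIV_add)
  show ?thesis
    unfolding has_ou_def
  proof (intro exI conjI allI)
    show "(\<lambda>x. g x + g' x) = (\<lambda>x. (\<Sum>i\<in>UNIV. f2 i x + e2 i x) - (\<Sum>i\<in>UNIV. x $ i * (f1 i x + e1 i x)))"
      unfolding f(3) e(3) by (simp add: sum.distrib distrib_left fun_eq_iff)
  qed (rule p)+
qed

lemma has_ou_cmult:
  assumes "has_ou f g"
  shows "has_ou (\<lambda>x. c * f x) (\<lambda>x. c * g x)"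
proof -
  from assms(1) obtain f1 f2 where
    f: "\<And>i. has_partial i f (f1 i)" "\<And>i. has_partial i (f1 i) (f2 i)"
       "g = (\<lambda>x. (\<Sum>i\<in>UNIV. f2 i x) - (\<Sum>i\<in>UNIV. x $ i * f1 i x))"
    unfolding has_ou_def by blast
  have p: "has_partial i (\<lambda>x. c * f x) (\<lambda>x. c * f1 i x)"
          "has_partial i (\<lambda>x. c * f1 i x) (\<lambda>x. c * f2 i x)" for i
    using f(1,2)[of i] unfolding has_partial_def by (auto simp only: intro!: DERIV_cmult)
  show ?thesis
    unfolding has_ou_def
  proof (intro exI conjI allI)
    show "(\<lambda>x. c * g x) = (\<lambda>x. (\<Sum>i\<in>UNIV. c * f2 i x) - (\<Sum>i\<in>UNIV. x $ i * (c * f1 i x)))"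
      unfolding f(3) by (simp add: sum_distrib_left right_diff_distrib mult.left_commute)
  qed (rule p)+
qed

lemma has_ou_sum:
  "finite A \<Longrightarrow> (\<And>a. a \<in> A \<Longrightarrow> has_ou (f a) (g a)) \<Longrightarrow>
   has_ou (\<lambda>x. \<Sum>a\<in>A. f a x) (\<lambda>x. \<Sum>a\<in>A. g a x)"
  by (induction A rule: finite_induct) (auto intro: has_ou_0 has_ou_add)

lemma has_partial_poly_prod:
  fixes p :: "'n::finite \<Rightarrow> real poly"
  shows "has_partial i (\<lambda>x. poly (p i) (x $ i) * (\<Prod>j\<in>UNIV - {i}. poly (q j) (x $ j)))
           (\<lambda>x. poly (pderiv (p i)) (x $ i) * (\<Prod>j\<in>UNIV - {i}. poly (q j) (x $ j)))"
  unfolding has_partial_def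
proof
  fix x :: "real ^ 'n"
  have *: "(x + t *\<^sub>R axis i 1) $ j = (if j = i then x $ i + t else x $ j)" for t j
    by (simp add: axis_def)
  have "((\<lambda>t. poly (p i) (x $ i + t)) has_field_derivative poly (pderiv (p i)) (x $ i + 0)) (at 0)"
    using DERIV_shift[of "poly (p i)" "poly (pderiv (p i)) (x $ i + 0)" 0 "x $ i"] poly_DERIV[of "p i" "x $ i"]
    by (simp add: add.commute)
  from DERIV_cmult_right[OF this, of "\<Prod>j\<in>UNIV - {i}. poly (q j) (x $ j)"]
  show "((\<lambda>t. poly (p i) ((x + t *\<^sub>R axis i 1) $ i)
        * (\<Prod>j\<in>UNIV - {i}. poly (q j) ((x + t *\<^sub>R axis i 1) $ j))) has_field_derivative
     poly (pderiv (p i)) (x $ i) * (\<Prod>j\<in>UNIV - {i}. poly (q j) (x $ j))) (at 0)"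
    by (simp only: * if_True refl cong: prod.cong) simp
qed

lemma hermite_prod_split:
  "hermite_prod a x = poly (hermite (a i)) (x $ i) * (\<Prod>j\<in>UNIV - {i}. poly (hermite (a j)) (x $ j))"
  unfolding hermite_prod_def by (rule prod.remove) auto

lemma has_ou_hermite_prod:
  "has_ou (hermite_prod a) (\<lambda>x. - real (\<Sum>j\<in>UNIV. a j) * hermite_prod a x)"
proof -
  let ?R = "\<lambda>i (x :: real ^ 'a). \<Prod>j\<in>UNIV - {i}. poly (hermite (a j)) (x $ j)"
  let ?f1 = "\<lambda>i x. poly (pderiv (hermite (a i))) (x $ i) * ?R i x"
  let ?f2 = "\<lambda>i x. poly (pderiv (pderiv (hermite (a i)))) (x $ i) * ?R i x"
  have 1: "has_partial i (hermite_prod a) (?f1 i)" for i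
    using has_partial_poly_prod[of i "\<lambda>j. hermite (a j)" "\<lambda>j. hermite (a j)"]
    by (simp add: hermite_prod_split[of a _ i, abs_def])
  have 2: "has_partial i (?f1 i) (?f2 i)" for i
    using has_partial_poly_prod[of i "\<lambda>j. pderiv (hermite (a j))" "\<lambda>j. hermite (a j)"] by simp
  have ode: "?f2 i x - x $ i * ?f1 i x = - real (a i) * hermite_prod a x" for i x
  proof -
    have "poly (pderiv (pderiv (hermite (a i))) - [:0, 1:] * pderiv (hermite (a i))) (x $ i)
        = poly (- (of_nat (a i) * hermite (a i))) (x $ i)"
      using hermite_ode[of "a i"] by simp
    then have "poly (pderiv (pderiv (hermite (a i)))) (x $ i) - x $ i * poly (pderiv (hermite (a i))) (x $ i)
        = - real (a i) * poly (hermite (a i)) (x $ i)"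
      by (simp add: of_nat_poly)
    then have "(poly (pderiv (pderiv (hermite (a i)))) (x $ i) - x $ i * poly (pderiv (hermite (a i))) (x $ i)) * ?R i x
        = (- real (a i) * poly (hermite (a i)) (x $ i)) * ?R i x"
      by simp
    then show ?thesis
      unfolding hermite_prod_split[of a x i] by (simp add: algebra_simps)
  qed
  have "- real (\<Sum>j\<in>UNIV. a j) * hermite_prod a x
      = (\<Sum>i\<in>UNIV. ?f2 i x) - (\<Sum>i\<in>UNIV. x $ i * ?f1 i x)" for x
    by (simp only: sum_subtractf[symmetric] ode) (simp add: sum_distrib_right sum_negf)
  then show ?thesis
    unfolding has_ou_def using 1 2 by (intro exI[of _ ?f1] exI[of _ ?f2]) auto
qed

lemma has_ou_hermite_chaos:
  assumes "F \<in> hermite_chaos k"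
  shows "has_ou F (\<lambda>x. - real k * F x)"
proof -
  obtain \<alpha> where F: "F = (\<lambda>x. \<Sum>a | (\<Sum>j\<in>UNIV. a j) = k. \<alpha> a * hermite_prod a x)"
    using assms by (auto simp: hermite_chaos_def)
  have "has_ou F (\<lambda>x. \<Sum>a | (\<Sum>j\<in>UNIV. a j) = k. \<alpha> a * (- real (\<Sum>j\<in>UNIV. a j) * hermite_prod a x))"
    unfolding F by (intro has_ou_sum finite_multi_indices has_ou_cmult has_ou_hermite_prod)
  also have "(\<lambda>x. \<Sum>a | (\<Sum>j\<in>UNIV. a j) = k. \<alpha> a * (- real (\<Sum>j\<in>UNIV. a j) * hermite_prod a x))
      = (\<lambda>x. - real k * F x)"
    unfolding F by (rule ext, simp only: sum_distrib_left, rule sum.cong) (auto simp: algebra_simps)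
  finally show ?thesis .
qed

lemma hermite_chaos_0: "(\<lambda>x. 0) \<in> hermite_chaos k"
  unfolding hermite_chaos_def by (auto intro!: exI[of _ "\<lambda>a. 0"])

lemma hermite_chaos_add:
  assumes "F \<in> hermite_chaos k" "G \<in> hermite_chaos k"
  shows "(\<lambda>x. F x + G x) \<in> hermite_chaos k"
proof -
  obtain \<alpha> \<beta> where "F = (\<lambda>x. \<Sum>a | (\<Sum>j\<in>UNIV. a j) = k. \<alpha> a * hermite_prod a x)"
    "G = (\<lambda>x. \<Sum>a | (\<Sum>j\<in>UNIV. a j) = k. \<beta> a * hermite_prod a x)"
    using assms by (auto simp: hermite_chaos_def)
  then show ?thesis
    unfolding hermite_chaos_def
    by (auto intro!: exI[of _ "\<lambda>a. \<alpha> a + \<beta> a"] simp: algebra_simps sum.distrib)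
qed

lemma hermite_chaos_cmult:
  assumes "F \<in> hermite_chaos k"
  shows "(\<lambda>x. c * F x) \<in> hermite_chaos k"
proof -
  obtain \<alpha> where "F = (\<lambda>x. \<Sum>a | (\<Sum>j\<in>UNIV. a j) = k. \<alpha> a * hermite_prod a x)"
    using assms by (auto simp: hermite_chaos_def)
  then show ?thesis
    unfolding hermite_chaos_def
    by (auto intro!: exI[of _ "\<lambda>a. c * \<alpha> a"] simp: algebra_simps sum_distrib_left)
qed

lemma hermite_prod_in_chaos: "hermite_prod a \<in> hermite_chaos (\<Sum>j\<in>UNIV. a j)"
proof -
  have "(\<Sum>b | (\<Sum>j\<in>UNIV. b j) = (\<Sum>j\<in>UNIV. a j). (if b = a then 1 else 0) * hermite_prod b x)
      = hermite_prod a x" for x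
  proof -
    have "(\<Sum>b | (\<Sum>j\<in>UNIV. b j) = (\<Sum>j\<in>UNIV. a j). (if b = a then 1 else 0) * hermite_prod b x)
        = (\<Sum>b\<in>{a}. (if b = a then 1 else 0) * hermite_prod b x)"
      by (rule sum.mono_neutral_right) (auto simp: finite_multi_indices)
    then show ?thesis by simp
  qed
  then show ?thesis
    unfolding hermite_chaos_def by (auto intro!: exI[of _ "\<lambda>b. if b = a then 1 else 0"])
qed

lemma real_polynomial_function_hermite_prod: "real_polynomial_function (hermite_prod a)"
proof -
  have "real_polynomial_function (\<lambda>x :: real ^ 'a. poly p (x $ j))" for p j
  proof (induction p)
    case 0
    show ?case by (simp add: real_polynomial_function.intros)
  next
    case (pCons c p)
    have "real_polynomial_function (\<lambda>x :: real ^ 'a. x $ j)"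
      by (intro real_polynomial_function.intros(1) bounded_linear_vec_nth)
    with pCons show ?case
      by (simp add: real_polynomial_function.intros)
  qed
  then show ?thesis
    unfolding hermite_prod_def[abs_def] by (intro real_polynomial_function_prod) auto
qed

lemma hermite_chaos_subset: "hermite_chaos k \<subseteq> wiener_chaos k"
proof
  fix F assume F: "F \<in> (hermite_chaos k :: (real ^ 'a \<Rightarrow> real) set)"
  then obtain \<alpha> where e: "F = (\<lambda>x. \<Sum>a | (\<Sum>j\<in>UNIV. a j) = k. \<alpha> a * hermite_prod a x)"
    by (auto simp: hermite_chaos_def)
  have "real_polynomial_function (\<lambda>x. \<alpha> a * hermite_prod a x)" for a
    by (rule real_polynomial_function.intros(4)[OF real_polynomial_function.intros(2)
          real_polynomial_function_hermite_prod])
  then have "real_polynomial_function F"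
    unfolding e by (rule real_polynomial_function_sum[OF finite_multi_indices])
  then show "F \<in> wiener_chaos k"
    using has_ou_imp[OF has_ou_hermite_chaos[OF F]] by (simp add: wiener_chaos_def)
qed

inductive hermite_span :: "(real ^ 'n \<Rightarrow> real) \<Rightarrow> bool" where
  base: "hermite_span (hermite_prod a)"
| scale: "hermite_span f \<Longrightarrow> hermite_span (\<lambda>x. c * f x)"
| add: "hermite_span f \<Longrightarrow> hermite_span g \<Longrightarrow> hermite_span (\<lambda>x. f x + g x)"

lemma hermite_span_0: "hermite_span (\<lambda>x. 0)"
  using hermite_span.scale[OF hermite_span.base, of 0] by simp

lemma hermite_span_sum:
  "finite A \<Longrightarrow> (\<And>a. a \<in> A \<Longrightarrow> hermite_span (f a)) \<Longrightarrow> hermite_span (\<lambda>x. \<Sum>a\<in>A. f a x)"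
  by (induction A rule: finite_induct) (auto intro: hermite_span_0 hermite_span.add)

lemma hermite_span_coord:
  "hermite_span f \<Longrightarrow> hermite_span (\<lambda>x. x $ i * f x)"
proof (induction rule: hermite_span.induct)
  case (base a)
  have upd: "hermite_prod (a(i := m)) x
      = poly (hermite m) (x $ i) * (\<Prod>j\<in>UNIV - {i}. poly (hermite (a j)) (x $ j))" for m x
    unfolding hermite_prod_split[of _ x i] by simp
  have pd: "pderiv (hermite m) = of_nat m * hermite (m - 1)" for m
    using hermite_ode[of "m - 1"] by (cases m) auto
  have "poly (hermite (Suc m)) y = y * poly (hermite m) y - real m * poly (hermite (m - 1)) y" for m y
    by (simp add: pd of_nat_poly)
  then have rec: "y * poly (hermite m) y = poly (hermite (Suc m)) y + real m * poly (hermite (m - 1)) y" for m y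
    by (metis add.commute diff_add_cancel)
  have "x $ i * hermite_prod a x
      = hermite_prod (a(i := Suc (a i))) x + real (a i) * hermite_prod (a(i := a i - 1)) x" for x
    unfolding upd hermite_prod_split[of a x i] mult.assoc[symmetric] rec
    by (simp only: distrib_right)
  then show ?case
    by (auto intro!: hermite_span.intros)
next
  case (scale f c)
  from hermite_span.scale[OF scale.IH, of c] show ?case
    by (simp add: algebra_simps)
next
  case (add f g)
  from hermite_span.add[OF add.IH] show ?case
    by (simp add: algebra_simps)
qed

lemma hermite_span_mult:
  "real_polynomial_function p \<Longrightarrow> hermite_span f \<Longrightarrow> hermite_span (\<lambda>x. p x * f x)"
proof (induction arbitrary: f rule: real_polynomial_function.induct)
  case (linear p)
  interpret bounded_linear p by fact
  have "p x * f x = (\<Sum>j\<in>UNIV. p (axis j 1) * (x $ j * f x))" for x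
  proof -
    have "p x = p (\<Sum>j\<in>UNIV. (x $ j) *\<^sub>R axis j 1)"
      using basis_expansion[of x] by (simp add: scalar_mult_eq_scaleR)
    also have "\<dots> = (\<Sum>j\<in>UNIV. p (axis j 1) * (x $ j))"
      by (simp add: sum scaleR mult.commute)
    finally show ?thesis
      by (simp only: sum_distrib_right mult.assoc)
  qed
  then have e: "(\<lambda>x. p x * f x) = (\<lambda>x. \<Sum>j\<in>UNIV. p (axis j 1) * (x $ j * f x))"
    by (rule ext)
  show ?case
    unfolding e
    by (rule hermite_span_sum[OF finite hermite_span.scale[OF hermite_span_coord[OF linear.prems]]])
next
  case (const c)
  then show ?case by (rule hermite_span.scale)
next
  case (add p q)
  from hermite_span.add[OF add.IH(1)[OF add.prems] add.IH(2)[OF add.prems]]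
  show ?case by (simp add: algebra_simps)
next
  case (mult p q)
  from mult.IH(1)[OF mult.IH(2)[OF mult.prems]] show ?case by (simp add: mult.assoc)
qed

lemma hermite_span_poly:
  fixes p :: "real ^ 'n \<Rightarrow> real"
  assumes "real_polynomial_function p"
  shows "hermite_span p"
proof -
  have "hermite_span (\<lambda>x :: real ^ 'n. 1)"
    using hermite_span.base[of "\<lambda>_ :: 'n. 0"] by (simp add: hermite_prod_def[abs_def])
  from hermite_span_mult[OF assms this] show ?thesis by simp
qed

lemma hermite_span_decomp:
  "hermite_span f \<Longrightarrow>
   \<exists>M G. finite M \<and> (\<forall>m. G m \<in> hermite_chaos m) \<and> (\<forall>m. m \<notin> M \<longrightarrow> G m = (\<lambda>x. 0)) \<and>
     f = (\<lambda>x. \<Sum>m\<in>M. G m x)"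
proof (induction rule: hermite_span.induct)
  case (base a)
  let ?s = "\<Sum>j\<in>UNIV. a j"
  show ?case
    by (rule exI[of _ "{?s}"], rule exI[of _ "\<lambda>m. if m = ?s then hermite_prod a else (\<lambda>x. 0)"])
       (auto simp: hermite_chaos_0 hermite_prod_in_chaos)
next
  case (scale f c)
  then obtain M G where "finite M" "\<forall>m. G m \<in> hermite_chaos m" "\<forall>m. m \<notin> M \<longrightarrow> G m = (\<lambda>x. 0)"
     "f = (\<lambda>x. \<Sum>m\<in>M. G m x)" by blast
  then show ?case
    by - (rule exI[of _ M], rule exI[of _ "\<lambda>m x. c * G m x"], auto simp: hermite_chaos_cmult sum_distrib_left)
next
  case (add f g)
  obtain M G where G: "finite M" "\<forall>m. G m \<in> hermite_chaos m" "\<forall>m. m \<notin> M \<longrightarrow> G m = (\<lambda>x. 0)"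
     "f = (\<lambda>x. \<Sum>m\<in>M. G m x)" using add.IH(1) by blast
  obtain N H where H: "finite N" "\<forall>m. H m \<in> hermite_chaos m" "\<forall>m. m \<notin> N \<longrightarrow> H m = (\<lambda>x. 0)"
     "g = (\<lambda>x. \<Sum>m\<in>N. H m x)" using add.IH(2) by blast
  have "f x = (\<Sum>m\<in>M \<union> N. G m x)" "g x = (\<Sum>m\<in>M \<union> N. H m x)" for x
    unfolding G(4) H(4) using G(1,3) H(1,3) by (auto intro!: sum.mono_neutral_left)
  then show ?case
    using G(1-3) H(1-3)
    by - (rule exI[of _ "M \<union> N"], rule exI[of _ "\<lambda>m x. G m x + H m x"],
      auto simp: hermite_chaos_add sum.distrib)
qed

lemma hermite_chaos_independent:
  assumes "finite M" "\<And>m. m \<in> M \<Longrightarrow> G m \<in> hermite_chaos m" "\<And>x. (\<Sum>m\<in>M. G m x) = 0" "m \<in> M"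
  shows "G m x = 0"
  using assms
proof (induction M arbitrary: G m x rule: finite_induct)
  case empty
  then show ?case by simp
next
  case (insert b M)
  have "has_ou (\<lambda>x. \<Sum>m\<in>insert b M. G m x) (\<lambda>x. \<Sum>m\<in>insert b M. - real m * G m x)"
    using insert by (intro has_ou_sum has_ou_hermite_chaos) auto
  from has_ou_imp[OF this] have "(\<Sum>m\<in>insert b M. - real m * G m x) = ou_generator (\<lambda>x. 0) x" for x
    using insert.prems(2) by (simp add: fun_eq_iff)
  then have "(\<Sum>m\<in>insert b M. - real m * G m x) = 0" for x
    by (simp add: has_ou_imp[OF has_ou_0])
  then have "real b * (\<Sum>m\<in>insert b M. G m x) + (\<Sum>m\<in>insert b M. - real m * G m x) = 0" for x
    using insert.prems(2) by simp
  then have s: "(\<Sum>m\<in>M. (real b - real m) * G m x) = 0" for x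
    using insert.hyps by (simp add: sum_distrib_left sum_subtractf sum_negf algebra_simps)
  have "(real b - real l) * G l y = 0" if "l \<in> M" for l y
    using insert.IH[of "\<lambda>m x. (real b - real m) * G m x", OF _ s that] insert.prems(1)
    by (auto intro: hermite_chaos_cmult)
  then have z: "G l y = 0" if "l \<in> M" for l y
    using that insert.hyps(2) by force
  then have "G b y = 0" for y
    using insert.prems(2)[of y] insert.hyps by simp
  then show ?case using z insert.prems(3) by auto
qed

theorem wiener_chaos_eq_hermite: "wiener_chaos k = hermite_chaos k"
proof
  show "wiener_chaos k \<subseteq> (hermite_chaos k :: (real ^ 'n \<Rightarrow> real) set)"
  proof
    fix F :: "real ^ 'n \<Rightarrow> real" assume F: "F \<in> wiener_chaos k"
    then obtain M G where G: "finite M" "\<And>m. G m \<in> hermite_chaos m"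
        "\<And>m. m \<notin> M \<Longrightarrow> G m = (\<lambda>x. 0)" "F = (\<lambda>x. \<Sum>m\<in>M. G m x)"
      using hermite_span_decomp[OF hermite_span_poly] unfolding wiener_chaos_def by blast
    have "has_ou F (\<lambda>x. \<Sum>m\<in>M. - real m * G m x)"
      unfolding G(4) using G(1,2) by (intro has_ou_sum has_ou_hermite_chaos)
    from has_ou_imp[OF this] F have "(\<Sum>m\<in>M. - real m * G m x) + real k * F x = 0" for x
      by (simp add: wiener_chaos_def)
    then have s: "(\<Sum>m\<in>M. (real k - real m) * G m x) = 0" for x
      by (simp add: G(4) sum_distrib_left sum_subtractf sum_negf algebra_simps)
    have "(real k - real m) * G m x = 0" if "m \<in> M" for m x
      using hermite_chaos_independent[of M "\<lambda>m x. (real k - real m) * G m x", OF G(1) _ s that]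
        G(2) by (auto intro: hermite_chaos_cmult)
    then have z: "G m x = 0" if "m \<noteq> k" for m x
      using that G(3)[of m] by (cases "m \<in> M") force+
    have "F x = G k x" for x
    proof (cases "k \<in> M")
      case True
      then show ?thesis
        unfolding G(4) using G(1) z by (subst sum.remove[of M k]) auto
    next
      case False
      then have "\<forall>m\<in>M. G m x = 0" using z by metis
      with False show ?thesis
        unfolding G(4) using G(3)[of k] by simp
    qed
    then have "F = G k" by (rule ext)
    then show "F \<in> hermite_chaos k" using G(2)[of k] by simp
  qed
qed (rule hermite_chaos_subset)

end

theory Submission
  imports Defs
begin

text \<open>
  Write \<open>F\<^sub>i = \<Sum>\<^sub>a \<alpha>\<^sub>i(a) H\<^sub>a\<close> with \<open>|a| = k\<^sub>i\<close> and let \<open>P\<^sub>i(x) = \<Sum>\<^sub>a \<alpha>\<^sub>i(a) x\<^sup>a\<close> be the homogeneous polynomial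
  with the same coefficients. Hermite products are orthogonal with squared norm \<open>a!\<close>, so
  \<open>E[F\<^sub>i\<^sup>2]\<close> is the squared Fischer norm \<open>\<Sum>\<^sub>a a! \<alpha>\<^sub>i(a)\<^sup>2\<close> of \<open>P\<^sub>i\<close>. Hermite polynomials are monic, so the
  component of \<open>\<Prod> F\<^sub>i\<close> in the top chaos, of order \<open>\<Sum> k\<^sub>i\<close>, has the coefficients of \<open>\<Prod> P\<^sub>i\<close>; by
  Bessel's inequality (\<open>hermite_bessel_inequality\<close>, \<open>gauss_integral_product_hermite\<close>) the second
  moment of \<open>\<Prod> F\<^sub>i\<close> is at least the squared Fischer norm of \<open>\<Prod> P\<^sub>i\<close>. The inequality therefore follows
  from the fact that the Fischer norm is supermultiplicative on homogeneous polynomials, which is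
  Bombieri's inequality. Its proof here is Reznick's identity
  \<open>\<parallel>P Q\<parallel>\<^sup>2 = \<Sum>\<^sub>a \<parallel>(\<partial>\<^sup>a P)(\<partial>) Q\<parallel>\<^sup>2 / a!\<close> (\<open>fischer_norm2_form_mult\<close>),
  in which the terms with \<open>|a| = deg P\<close> already sum to \<open>\<parallel>P\<parallel>\<^sup>2 \<parallel>Q\<parallel>\<^sup>2\<close>.

  In the case of equality the other terms vanish for each pair \<open>P\<^sub>i, P\<^sub>j\<close>, because the remaining factors
  have positive norm and can be cancelled. For \<open>|a| = k\<^sub>i - 1\<close> the polynomial \<open>\<partial>\<^sup>a P\<^sub>i\<close> is a linear form,
  and the vanishing of \<open>(\<partial>\<^sup>a P\<^sub>i)(\<partial>) P\<^sub>j\<close> says that the gradient of \<open>\<partial>\<^sup>a P\<^sub>i\<close> is orthogonal to the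
  gradient of every \<open>\<partial>\<^sup>b P\<^sub>j\<close> with \<open>|b| = k\<^sub>j - 1\<close>
  (\<open>fischer_norm2_form_mult_eq_imp_orthogonal\<close>). Let \<open>V\<^sub>i\<close> be the span of these gradients for \<open>P\<^sub>i\<close>. Then
  \<open>F\<^sub>i\<close> is invariant under translations orthogonal to \<open>V\<^sub>i\<close> (\<open>hermite_form_translate\<close>), so that
  \<open>F\<^sub>1, \<dots>, F\<^sub>d\<close> depend on the projections of \<open>x\<close> to pairwise orthogonal subspaces. These projections are
  independent because the Gaussian measure is invariant under orthogonal maps
  (\<open>indep_vars_orthogonal_subspaces\<close>).
\<close>

section \<open>Hermite polynomials in one Gaussian variable\<close>

definition normal_expect :: "real poly \<Rightarrow> real" where
  "normal_expect p = (LINT x|std_normal_distribution. poly p x)"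

lemma integrable_poly_std_normal: "integrable std_normal_distribution (poly p)"
  unfolding poly_altdef
  by (intro Bochner_Integration.integrable_sum integrable_mult_right integrable_std_normal_distribution_moment)

lemma normal_expect_add: "normal_expect (p + q) = normal_expect p + normal_expect q"
  unfolding normal_expect_def poly_add by (intro Bochner_Integration.integral_add integrable_poly_std_normal)

lemma normal_expect_smult: "normal_expect (smult c p) = c * normal_expect p"
  by (simp add: normal_expect_def)

lemma normal_expect_diff: "normal_expect (p - q) = normal_expect p - normal_expect q"
  unfolding normal_expect_def poly_diff by (intro Bochner_Integration.integral_diff integrable_poly_std_normal)

lemma normal_expect_1 [simp]: "normal_expect 1 = 1"
  using std_normal_distribution_even_moments(1)[of 0] by (simp add: normal_expect_def)

lemma normal_expect_monom_Suc:
  "normal_expect (monom 1 (Suc m)) = of_nat m * normal_expect (monom 1 (m - 1))"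
proof (cases "even m")
  case True
  then show ?thesis
    using integral_std_normal_distribution_moment_odd[of "Suc m"]
      integral_std_normal_distribution_moment_odd[of "m - 1"]
    by (cases "m = 0") (simp_all add: normal_expect_def poly_monom)
next
  case False
  then obtain k where k: "m = Suc (2 * k)" by (metis oddE Suc_eq_plus1)
  have "fact (2 * Suc k) / (2 ^ Suc k * fact (Suc k))
      = (2 * (1 + real k)) * ((2 * real k + 1) * fact (2 * k)) / (2 * (1 + real k) * (2 ^ k * fact k))"
    by (simp add: algebra_simps)
  also have "\<dots> = (2 * real k + 1) * (fact (2 * k) / (2 ^ k * fact k))"
    by (subst mult_divide_mult_cancel_left) auto
  finally have "normal_expect (monom 1 (2 * Suc k)) = (2 * real k + 1) * normal_expect (monom 1 (2 * k))"
    unfolding normal_expect_def poly_monom mult_1 std_normal_distribution_even_moments(1) .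
  then show ?thesis
    by (simp add: k)
qed

text \<open>Gaussian integration by parts, here a consequence of the recursion for the moments: for monomials
  it is the preceding lemma, and both sides are linear. The factor \<open>monom 1 m\<close> generalises the claim
  so that it can be proved by induction over the coefficients of the polynomial.\<close>

lemma stein_identity: "normal_expect ([:0, 1:] * p) = normal_expect (pderiv p)"
proof -
  have "normal_expect ([:0, 1:] * (monom 1 m * p)) = normal_expect (pderiv (monom 1 m * p))" for m
  proof (induction p arbitrary: m)
    case 0
    then show ?case by simp
  next
    case (pCons c p)
    have split: "monom 1 m * pCons c p = smult c (monom 1 m) + monom 1 (Suc m) * p" for m
      by (simp add: monom_Suc smult_monom)
    have "normal_expect ([:0, 1:] * smult c (monom 1 m)) = normal_expect (pderiv (smult c (monom 1 m)))"
    proof -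
      have "[:0, 1:] * monom 1 m = monom (1::real) (Suc m)" by (simp add: monom_Suc)
      moreover have "pderiv (monom 1 m) = smult (of_nat m) (monom (1::real) (m - 1))"
        by (simp add: pderiv_monom smult_monom)
      ultimately show ?thesis
        by (simp only: mult_smult_right pderiv_smult normal_expect_smult normal_expect_monom_Suc)
    qed
    then show ?case
      unfolding split distrib_left pderiv_add normal_expect_add pCons.IH[of "Suc m"] by simp
  qed
  from this[of 0] show ?thesis by simp
qed

text \<open>The operator \<open>p \<mapsto> x p - p'\<close> that generates the Hermite polynomials is adjoint to
  differentiation, by \<open>stein_identity\<close> applied to a product.\<close>

lemma hermite_normal_expect:
  "normal_expect (hermite m * q) = normal_expect ((pderiv ^^ m) q)"
proof (induction m arbitrary: q)
  case 0
  then show ?case by simp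
next
  case (Suc m)
  have "hermite (Suc m) * q
      = [:0, 1:] * (hermite m * q) - pderiv (hermite m * q) + hermite m * pderiv q"
    unfolding hermite.simps pderiv_mult by (simp only: algebra_simps)
  then have "normal_expect (hermite (Suc m) * q) = normal_expect (hermite m * pderiv q)"
    by (simp only: normal_expect_add normal_expect_diff stein_identity)
  also have "\<dots> = normal_expect ((pderiv ^^ m) (pderiv q))" by (rule Suc)
  finally show ?case by (simp add: funpow_swap1)
qed

text \<open>Orthogonality and normalisation in one statement: \<open>H\<^sub>m\<close> reads off the coefficient of degree \<open>m\<close>
  of any polynomial of degree at most \<open>m\<close>.\<close>

lemma hermite_normal_expect_le:
  assumes "degree q \<le> m"
  shows "normal_expect (hermite m * q) = fact m * coeff q m"
proof -
  have "(pderiv ^^ m) q = [:fact m * coeff q m:]"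
  proof (rule poly_eqI)
    fix n
    show "coeff ((pderiv ^^ m) q) n = coeff [:fact m * coeff q m:] n"
      using assms by (cases n) (simp_all add: coeff_higher_pderiv pochhammer_fact coeff_eq_0)
  qed
  moreover have "normal_expect [:c:] = c" for c
    using normal_expect_smult[of c 1] by simp
  ultimately show ?thesis by (simp add: hermite_normal_expect)
qed

lemma degree_hermite_monic: "degree (hermite m) = m \<and> coeff (hermite m) m = 1"
proof (induction m)
  case 0
  then show ?case by simp
next
  case (Suc m)
  have d: "degree (pderiv (hermite m)) \<le> m"
    using Suc by (simp add: degree_pderiv)
  have "coeff (hermite (Suc m)) n = (if n = 0 then 0 else coeff (hermite m) (n - 1)) - coeff (pderiv (hermite m)) n" for n
    by (cases n) (simp_all)
  moreover have "coeff (pderiv (hermite m)) n = 0" if "n > m" for n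
    using d that by (simp add: coeff_eq_0)
  ultimately have c: "coeff (hermite (Suc m)) (Suc m) = 1" "\<And>n. n > Suc m \<Longrightarrow> coeff (hermite (Suc m)) n = 0"
    using Suc by (auto simp: coeff_eq_0)
  have "degree (hermite (Suc m)) \<le> Suc m" by (rule degree_le) (use c in auto)
  moreover have "Suc m \<le> degree (hermite (Suc m))" by (rule le_degree) (use c in auto)
  ultimately show ?case using c by (simp del: hermite.simps)
qed

lemma degree_prod_hermite_monic:
  assumes "finite S"
  shows "degree (\<Prod>i\<in>S. hermite (a i)) = (\<Sum>i\<in>S. a i) \<and> coeff (\<Prod>i\<in>S. hermite (a i)) (\<Sum>i\<in>S. a i) = 1"
  using assms
proof (induction S rule: finite_induct)
  case empty
  then show ?case by simp
next
  case (insert x S)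
  have nz: "hermite n \<noteq> 0" for n using degree_hermite_monic[of n] by auto
  have nz': "(\<Prod>i\<in>S. hermite (a i)) \<noteq> 0" using nz insert by auto
  have "lead_coeff (hermite (a x) * (\<Prod>i\<in>S. hermite (a i))) = 1"
    using insert degree_hermite_monic[of "a x"] by (subst lead_coeff_mult) simp
  then show ?case
    using insert degree_hermite_monic[of "a x"] by (auto simp: degree_mult_eq nz nz')
qed

section \<open>Coordinates under the Gaussian measure\<close>

lemma bij_betw_axis_Basis: "bij_betw (\<lambda>j. axis j 1) (UNIV :: 'n::finite set) (Basis :: (real ^ 'n) set)"
  by (auto simp: bij_betw_def inj_on_def axis_eq_axis Basis_vec_def)

text \<open>The coordinates are integrated against \<open>lborel\<close> along \<open>Basis\<close>; the auxiliary \<open>h\<close> moves the factors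
  from the index type to the basis vectors.\<close>

lemma nn_integral_gauss_prod:
  fixes g :: "'n::finite \<Rightarrow> real \<Rightarrow> ennreal"
  assumes [measurable]: "\<And>j. g j \<in> borel_measurable borel"
  shows "(\<integral>\<^sup>+x. (\<Prod>j\<in>UNIV. g j (x $ j)) \<partial>gauss_measure) = (\<Prod>j\<in>UNIV. \<integral>\<^sup>+y. g j y \<partial>std_normal_distribution)"
proof -
  define h where "h b = g (inv_into UNIV (\<lambda>j. axis j 1) b)" for b :: "real ^ 'n"
  have [measurable]: "h b \<in> borel_measurable borel" for b by (simp add: h_def)
  have h: "h (axis j 1) = g j" for j
    unfolding h_def by (simp add: bij_betw_inv_into_left[OF bij_betw_axis_Basis])
  note re = prod.reindex_bij_betw[OF bij_betw_axis_Basis, symmetric]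
  have "(\<integral>\<^sup>+x. (\<Prod>j\<in>UNIV. g j (x $ j)) \<partial>gauss_measure)
      = (\<integral>\<^sup>+x. (\<Prod>b\<in>Basis. ennreal (std_normal_density (x \<bullet> b))) * (\<Prod>b\<in>Basis. h b (x \<bullet> b)) \<partial>lborel)"
    unfolding gauss_measure_def gauss_density_prod
    by (subst nn_integral_density) (simp_all add: prod_ennreal re h inner_axis)
  also have "\<dots> = (\<integral>\<^sup>+x. (\<Prod>b\<in>Basis. ennreal (std_normal_density (x \<bullet> b)) * h b (x \<bullet> b)) \<partial>lborel)"
    by (simp add: prod.distrib)
  also have "\<dots> = (\<Prod>b\<in>Basis. \<integral>\<^sup>+y. ennreal (std_normal_density y) * h b y \<partial>lborel)"
    by (rule nn_integral_lborel_prod) simp_all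
  also have "\<dots> = (\<Prod>j\<in>UNIV. \<integral>\<^sup>+y. g j y \<partial>std_normal_distribution)"
    by (simp add: re h nn_integral_density)
  finally show ?thesis .
qed

lemma emeasure_gauss_rectangle:
  assumes [measurable]: "\<And>j. A j \<in> sets borel"
  shows "emeasure gauss_measure {x :: real ^ 'n. \<forall>j. x $ j \<in> A j} = (\<Prod>j\<in>UNIV. emeasure std_normal_distribution (A j))"
proof -
  have "indicator {x :: real ^ 'n. \<forall>j. x $ j \<in> A j} x = (\<Prod>j\<in>UNIV. indicator (A j) (x $ j) :: ennreal)" for x
    by (auto simp: indicator_def)
  then have "emeasure gauss_measure {x :: real ^ 'n. \<forall>j. x $ j \<in> A j}
      = (\<integral>\<^sup>+x. (\<Prod>j\<in>UNIV. indicator (A j) (x $ j)) \<partial>gauss_measure)"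
    by (simp flip: nn_integral_indicator)
  also have "\<dots> = (\<Prod>j\<in>UNIV. emeasure std_normal_distribution (A j))"
    by (subst nn_integral_gauss_prod) simp_all
  finally show ?thesis .
qed

lemma distr_gauss_coordinate:
  "distr gauss_measure borel (\<lambda>x :: real ^ 'n. x $ i) = std_normal_distribution"
proof (rule measure_eqI)
  interpret N: prob_space std_normal_distribution by (rule prob_space_normal_density) simp
  fix B assume "B \<in> sets (distr gauss_measure borel (\<lambda>x :: real ^ 'n. x $ i))"
  then have [measurable]: "B \<in> sets borel" by simp
  have "(\<lambda>x :: real ^ 'n. x $ i) -` B \<inter> space gauss_measure = {x. \<forall>j. x $ j \<in> (if j = i then B else UNIV)}"
    by auto
  then have "emeasure (distr gauss_measure borel (\<lambda>x :: real ^ 'n. x $ i)) B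
      = (\<Prod>j\<in>(UNIV :: 'n set). emeasure std_normal_distribution (if j = i then B else UNIV))"
    by (simp add: emeasure_distr emeasure_gauss_rectangle)
  also have "\<dots> = (\<Prod>j\<in>(UNIV :: 'n set). if j = i then emeasure std_normal_distribution B else 1)"
    using N.emeasure_space_1 by (intro prod.cong) auto
  finally show "emeasure (distr gauss_measure borel (\<lambda>x :: real ^ 'n. x $ i)) B = emeasure std_normal_distribution B"
    by simp
qed simp

lemma indep_vars_coordinates:
  "prob_space.indep_vars gauss_measure (\<lambda>_. borel) (\<lambda>j (x :: real ^ 'n). x $ j) UNIV"
proof -
  interpret N: prob_space std_normal_distribution by (rule prob_space_normal_density) simp
  interpret G: prob_space "gauss_measure :: (real ^ 'n) measure" by (rule prob_space_gauss_measure)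
  interpret P: product_sigma_finite "\<lambda>_::'n. std_normal_distribution"
    by (simp add: product_sigma_finite_def N.sigma_finite_measure_axioms)
  have "(\<Pi>\<^sub>M j\<in>(UNIV :: 'n set). std_normal_distribution)
      = distr gauss_measure (\<Pi>\<^sub>M j\<in>(UNIV :: 'n set). borel) (\<lambda>x :: real ^ 'n. \<lambda>j\<in>UNIV. x $ j)"
  proof (rule P.PiM_eqI[symmetric])
    show "sets (distr gauss_measure (\<Pi>\<^sub>M j\<in>(UNIV :: 'n set). borel) (\<lambda>x :: real ^ 'n. \<lambda>j\<in>UNIV. x $ j))
        = sets (\<Pi>\<^sub>M j\<in>(UNIV :: 'n set). std_normal_distribution)"
      by (simp cong: sets_PiM_cong)
    fix A :: "'n \<Rightarrow> real set" assume "\<And>j. j \<in> UNIV \<Longrightarrow> A j \<in> sets std_normal_distribution"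
    then have [measurable]: "A j \<in> sets borel" for j by simp
    have "(\<lambda>x :: real ^ 'n. \<lambda>j\<in>UNIV. x $ j) -` (PiE UNIV A) \<inter> space gauss_measure = {x. \<forall>j. x $ j \<in> A j}"
      by (auto simp: PiE_iff)
    then show "emeasure (distr gauss_measure (\<Pi>\<^sub>M j\<in>(UNIV :: 'n set). borel) (\<lambda>x :: real ^ 'n. \<lambda>j\<in>UNIV. x $ j)) (PiE UNIV A)
        = (\<Prod>j\<in>UNIV. emeasure std_normal_distribution (A j))"
      by (subst emeasure_distr) (auto simp: emeasure_gauss_rectangle intro!: sets_PiM_I_finite measurable_restrict)
  qed simp
  then show ?thesis
    by (subst G.indep_vars_iff_distr_eq_PiM) (simp_all add: distr_gauss_coordinate)
qed

lemma
  fixes p :: "'n::finite \<Rightarrow> real poly"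
  shows gauss_integrable_prod_poly: "integrable gauss_measure (\<lambda>x. \<Prod>j\<in>UNIV. poly (p j) (x $ j))"
    and gauss_integral_prod_poly: "(\<integral>x. (\<Prod>j\<in>UNIV. poly (p j) (x $ j)) \<partial>gauss_measure) = (\<Prod>j\<in>UNIV. normal_expect (p j))"
proof -
  interpret G: prob_space "gauss_measure :: (real ^ 'n) measure" by (rule prob_space_gauss_measure)
  have pm: "poly q \<in> borel_measurable borel" for q :: "real poly"
    by (intro borel_measurable_continuous_onI continuous_intros)
  have ind: "G.indep_vars (\<lambda>_. borel) (\<lambda>j x. poly (p j) (x $ j)) UNIV"
    by (rule G.indep_vars_compose2[OF indep_vars_coordinates]) (simp add: pm)
  have "integrable (distr gauss_measure borel (\<lambda>x :: real ^ 'n. x $ j)) (poly (p j))" for j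
    unfolding distr_gauss_coordinate by (rule integrable_poly_std_normal)
  then have int: "integrable gauss_measure (\<lambda>x :: real ^ 'n. poly (p j) (x $ j))" for j
    by (subst (asm) integrable_distr_eq) (simp_all add: pm)
  have val: "(\<integral>x. poly (p j) (x $ j) \<partial>(gauss_measure :: (real ^ 'n) measure)) = normal_expect (p j)" for j
    unfolding normal_expect_def distr_gauss_coordinate[of j, symmetric]
    by (rule integral_distr[symmetric]) (simp_all add: pm)
  show "integrable gauss_measure (\<lambda>x. \<Prod>j\<in>UNIV. poly (p j) (x $ j))"
    by (rule G.indep_vars_integrable[OF _ ind int]) simp
  show "(\<integral>x. (\<Prod>j\<in>UNIV. poly (p j) (x $ j)) \<partial>gauss_measure) = (\<Prod>j\<in>UNIV. normal_expect (p j))"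
    by (subst G.indep_vars_lebesgue_integral[OF _ ind int]) (simp_all add: val)
qed

text \<open>Every polynomial function lies in the span of the Hermite products, so this gives the
  integrability of all polynomials.\<close>

lemma gauss_integrable_hermite_span: "hermite_span f \<Longrightarrow> integrable gauss_measure f"
  by (induction rule: hermite_span.induct)
     (auto simp: hermite_prod_def[abs_def] intro: gauss_integrable_prod_poly)

lemma gauss_integrable_polynomial: "real_polynomial_function f \<Longrightarrow> integrable gauss_measure f"
  by (intro gauss_integrable_hermite_span hermite_span_poly)


section \<open>Invariance under orthogonal maps\<close>

text \<open>The uniqueness argument for Haar measure: with a Gaussian weight \<open>h\<close> of total mass one, for which
  \<open>h \<circ> T = h\<close>, the double integral of \<open>f(x) h(T y)\<close> equals the integral of \<open>f\<close>. Shifting \<open>x\<close> by \<open>T y\<close>,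
  then \<open>y\<close> by \<open>-T\<^sup>-\<^sup>1 x\<close>, turns the integrand into \<open>f(T y) h(T y - x)\<close>, whose integral is that of \<open>f \<circ> T\<close>.\<close>

lemma lborel_distr_orthogonal:
  fixes T :: "real ^ 'n \<Rightarrow> real ^ 'n"
  assumes T: "orthogonal_transformation T"
  shows "distr lborel borel T = lborel"
proof (rule measure_eqI)
  let ?h = "\<lambda>x :: real ^ 'n. ennreal ((2 * pi) powr (- real CARD('n) / 2) * exp (- (norm x)\<^sup>2 / 2))"
  have lin: "linear T" using T by (rule orthogonal_transformation_linear)
  have [measurable]: "T \<in> borel_measurable borel"
    by (intro borel_measurable_continuous_onI linear_continuous_on lin[unfolded linear_conv_bounded_linear])
  have hT: "?h (T x) = ?h x" for x
    using orthogonal_transformation_norm[OF T] by simp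
  have h1: "(\<integral>\<^sup>+x. ?h x \<partial>lborel) = 1"
    using prob_space.emeasure_space_1[OF prob_space_gauss_measure[where 'n='n]]
    by (simp add: gauss_measure_def emeasure_density)
  have shift: "(\<integral>\<^sup>+x. f (c + x) \<partial>lborel) = (\<integral>\<^sup>+x. f x \<partial>lborel)"
    if [measurable]: "f \<in> borel_measurable borel" for f :: "real ^ 'n \<Rightarrow> ennreal" and c
    by (subst lborel_distr_plus[of c, symmetric], subst nn_integral_distr) simp_all
  have reflect: "(\<integral>\<^sup>+x. ?h (c - x) \<partial>lborel) = 1" for c
  proof -
    have "(\<integral>\<^sup>+x. ?h (c - x) \<partial>lborel) = (\<integral>\<^sup>+x. ?h (- c + x) \<partial>lborel)"
      by (simp add: norm_minus_commute)
    then show ?thesis using shift[of ?h "- c"] h1 by simp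
  qed
  have invariant: "(\<integral>\<^sup>+x. f (T x) \<partial>lborel) = (\<integral>\<^sup>+x. f x \<partial>lborel)"
    if [measurable]: "f \<in> borel_measurable borel" for f
  proof -
    have "(\<integral>\<^sup>+x. f x \<partial>lborel) = (\<integral>\<^sup>+y. \<integral>\<^sup>+x. f x * ?h (T y) \<partial>lborel \<partial>lborel)"
      by (subst nn_integral_multc, simp, subst nn_integral_cmult, measurable) (simp only: hT h1 mult_1_right)
    also have "\<dots> = (\<integral>\<^sup>+y. \<integral>\<^sup>+x. f (T y + x) * ?h (T y) \<partial>lborel \<partial>lborel)"
    proof (rule nn_integral_cong)
      fix y
      have "(\<lambda>x. f x * ?h (T y)) \<in> borel_measurable borel" by measurable
      from shift[OF this, of "T y"]
      show "(\<integral>\<^sup>+x. f x * ?h (T y) \<partial>lborel) = (\<integral>\<^sup>+x. f (T y + x) * ?h (T y) \<partial>lborel)" ..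
    qed
    also have "\<dots> = (\<integral>\<^sup>+x. \<integral>\<^sup>+y. f (T y + x) * ?h (T y) \<partial>lborel \<partial>lborel)"
      by (rule lborel_pair.Fubini') measurable
    also have "\<dots> = (\<integral>\<^sup>+x. \<integral>\<^sup>+y. f (T y) * ?h (T y - x) \<partial>lborel \<partial>lborel)"
    proof (rule nn_integral_cong)
      fix x
      obtain z where z: "x = T z"
        using orthogonal_transformation_surj[OF T] by (metis surjD)
      have "(\<integral>\<^sup>+y. f (T y) * ?h (T y - x) \<partial>lborel) = (\<integral>\<^sup>+y. f (T (z + y)) * ?h (T (z + y) - x) \<partial>lborel)"
        by (rule shift[symmetric]) measurable
      then show "(\<integral>\<^sup>+y. f (T y + x) * ?h (T y) \<partial>lborel) = (\<integral>\<^sup>+y. f (T y) * ?h (T y - x) \<partial>lborel)"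
        by (simp add: linear_add[OF lin] z add.commute)
    qed
    also have "\<dots> = (\<integral>\<^sup>+y. \<integral>\<^sup>+x. f (T y) * ?h (T y - x) \<partial>lborel \<partial>lborel)"
      by (rule lborel_pair.Fubini') measurable
    also have "\<dots> = (\<integral>\<^sup>+y. f (T y) \<partial>lborel)"
      by (intro nn_integral_cong, subst nn_integral_cmult, measurable) (simp only: reflect mult_1_right)
    finally show ?thesis ..
  qed
  fix A :: "(real ^ 'n) set" assume "A \<in> sets (distr lborel borel T)"
  then have [measurable]: "A \<in> sets borel" by simp
  show "emeasure (distr lborel borel T) A = emeasure lborel A"
    using invariant[of "indicator A"] nn_integral_distr[of T lborel borel "indicator A"] by simp
qed simp

lemma gauss_distr_orthogonal:
  fixes T :: "real ^ 'n \<Rightarrow> real ^ 'n"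
  assumes T: "orthogonal_transformation T"
  shows "distr gauss_measure borel T = gauss_measure"
proof (rule measure_eqI)
  have [measurable]: "T \<in> borel_measurable borel"
    by (intro borel_measurable_continuous_onI linear_continuous_on
        orthogonal_transformation_linear[OF T, unfolded linear_conv_bounded_linear])
  let ?h = "\<lambda>x :: real ^ 'n. ennreal ((2 * pi) powr (- real CARD('n) / 2) * exp (- (norm x)\<^sup>2 / 2))"
  fix A :: "(real ^ 'n) set" assume "A \<in> sets (distr gauss_measure borel T)"
  then have [measurable]: "A \<in> sets borel" by simp
  have [measurable]: "T -` A \<in> sets borel"
    using measurable_sets[of T borel borel A] by simp
  have "emeasure (distr gauss_measure borel T) A = (\<integral>\<^sup>+x. ?h (T x) * indicator A (T x) \<partial>lborel)"
    by (simp add: emeasure_distr gauss_measure_def emeasure_density orthogonal_transformation_norm[OF T] indicator_vimage)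
  also have "\<dots> = (\<integral>\<^sup>+x. ?h x * indicator A x \<partial>distr lborel borel T)"
    by (simp add: nn_integral_distr)
  also have "\<dots> = emeasure gauss_measure A"
    by (simp add: lborel_distr_orthogonal[OF T] gauss_measure_def emeasure_density)
  finally show "emeasure (distr gauss_measure borel T) A = emeasure gauss_measure A" .
qed simp

lemma orthonormal_family_extends_to_basis:
  fixes S :: "(real ^ 'n) set"
  assumes S: "pairwise orthogonal S" "\<And>x. x \<in> S \<Longrightarrow> norm x = 1"
  obtains b :: "'n \<Rightarrow> real ^ 'n" where "S \<subseteq> range b" "inj b"
    "\<And>i j. b i \<bullet> b j = (if i = j then 1 else 0)"
proof -
  obtain U where U: "U \<inter> insert 0 S = {}" "pairwise orthogonal (S \<union> U)" "span (S \<union> U) = span (S \<union> UNIV)"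
    using orthogonal_extension_strong[OF S(1)] by blast
  define C where "C = (\<lambda>x. x /\<^sub>R norm x) ` (S \<union> U)"
  have "S \<subseteq> C"
  proof
    fix x assume "x \<in> S"
    then show "x \<in> C"
      unfolding C_def using S(2) by (intro image_eqI[of _ _ x]) auto
  qed
  have "pairwise orthogonal C"
    unfolding C_def pairwise_image
    using U(2) by (auto simp: pairwise_def orthogonal_def)
  have n: "norm x = 1" if "x \<in> C" for x
  proof -
    obtain y where y: "y \<in> S \<union> U" "x = y /\<^sub>R norm y" using \<open>x \<in> C\<close> unfolding C_def by blast
    then have "y \<noteq> 0" using U(1) S(2)[of y] by auto
    with y(2) show ?thesis by simp
  qed
  have "independent C"
    using n \<open>pairwise orthogonal C\<close> by (intro pairwise_orthogonal_independent) (auto dest: n)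
  have "S \<union> U \<subseteq> span C"
  proof
    fix x assume "x \<in> S \<union> U"
    then have "norm x *\<^sub>R (x /\<^sub>R norm x) \<in> span C"
      by (intro span_scale span_base) (simp add: C_def)
    then show "x \<in> span C" by (cases "x = 0") (simp_all add: span_zero)
  qed
  then have "span C = UNIV"
    using U(3) span_mono[of "S \<union> U" "span C"] by (auto simp: span_span)
  then have "card C = CARD('n)"
    using dim_eq_card_independent[OF \<open>independent C\<close>] dim_span[of C] by simp
  moreover have "finite C" using \<open>independent C\<close> by (rule independent_imp_finite)
  ultimately obtain b where b: "bij_betw b (UNIV :: 'n set) C"
    using finite_same_card_bij[of "UNIV :: 'n set" C] by auto
  have "b i \<bullet> b j = (if i = j then 1 else 0)" for i j
  proof (cases "i = j")
    case True
    then show ?thesis using n[OF bij_betw_apply[OF b UNIV_I]] by (simp add: norm_eq_1)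
  next
    case False
    then have "b i \<noteq> b j" using b by (auto simp: bij_betw_def inj_on_def)
    moreover have "b i \<in> C" "b j \<in> C" using b by (auto simp: bij_betw_def)
    ultimately show ?thesis
      using False \<open>pairwise orthogonal C\<close> by (auto simp: pairwise_def orthogonal_def)
  qed
  with that[of b] b \<open>S \<subseteq> C\<close> show ?thesis by (auto simp: bij_betw_def)
qed

text \<open>An orthogonal map \<open>T\<close> sending coordinate vectors to an orthonormal basis adapted to the subspaces
  makes \<open>F i \<circ> T\<close> a function of the coordinates in \<open>J i\<close>. The sets \<open>J i\<close> are disjoint, and \<open>T\<close> preserves
  the Gaussian measure, so independence is inherited from the coordinates.\<close>

lemma indep_vars_orthogonal_subspaces:
  fixes F :: "'i \<Rightarrow> real ^ 'n \<Rightarrow> real" and V :: "'i \<Rightarrow> (real ^ 'n) set"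
  assumes V: "\<And>i. i \<in> I \<Longrightarrow> subspace (V i)"
    and orth: "\<And>i j v w. i \<in> I \<Longrightarrow> j \<in> I \<Longrightarrow> i \<noteq> j \<Longrightarrow> v \<in> V i \<Longrightarrow> w \<in> V j \<Longrightarrow> v \<bullet> w = 0"
    and F [measurable]: "\<And>i. i \<in> I \<Longrightarrow> F i \<in> borel_measurable borel"
    and inv: "\<And>i x u. i \<in> I \<Longrightarrow> (\<And>v. v \<in> V i \<Longrightarrow> u \<bullet> v = 0) \<Longrightarrow> F i (x + u) = F i x"
  shows "prob_space.indep_vars gauss_measure (\<lambda>_. borel) F I"
proof -
  interpret G: prob_space "gauss_measure :: (real ^ 'n) measure" by (rule prob_space_gauss_measure)
  have "\<exists>B. B \<subseteq> V i \<and> pairwise orthogonal B \<and> (\<forall>x\<in>B. norm x = 1) \<and> span B = V i" if "i \<in> I" for i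
    using orthonormal_basis_subspace[OF V[OF that]] by metis
  then obtain B where B: "\<And>i. i \<in> I \<Longrightarrow> B i \<subseteq> V i" "\<And>i. i \<in> I \<Longrightarrow> pairwise orthogonal (B i)"
    "\<And>i x. i \<in> I \<Longrightarrow> x \<in> B i \<Longrightarrow> norm x = 1" "\<And>i. i \<in> I \<Longrightarrow> span (B i) = V i"
    by metis
  define S where "S = (\<Union>i\<in>I. B i)"
  have "pairwise orthogonal S"
    unfolding pairwise_def S_def
  proof safe
    fix i j x y assume *: "i \<in> I" "j \<in> I" "x \<in> B i" "y \<in> B j" "x \<noteq> y"
    show "orthogonal x y"
    proof (cases "i = j")
      case True
      then show ?thesis using * B(2)[of i] by (auto simp: pairwise_def)
    next
      case False
      then show ?thesis using * B(1) orth[of i j x y] by (auto simp: orthogonal_def)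
    qed
  qed
  moreover have "norm x = 1" if "x \<in> S" for x using that B(3) by (auto simp: S_def)
  ultimately obtain b :: "'n \<Rightarrow> real ^ 'n" where b: "S \<subseteq> range b" "inj b"
    "\<And>i j. b i \<bullet> b j = (if i = j then 1 else 0)"
    using orthonormal_family_extends_to_basis by blast
  define T where "T x = (\<Sum>j\<in>UNIV. x $ j *\<^sub>R b j)" for x
  have lin: "linear T"
    by (rule linearI) (simp_all add: T_def scaleR_add_left sum.distrib scaleR_sum_right)
  have [measurable]: "T \<in> borel_measurable borel"
    by (intro borel_measurable_continuous_onI linear_continuous_on lin[unfolded linear_conv_bounded_linear])
  have "T x \<bullet> T y = (\<Sum>j\<in>UNIV. x $ j * y $ j)" for x y
    by (simp add: T_def inner_sum_left inner_sum_right b(3) mult_delta_right mult.commute)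
  then have "T x \<bullet> T y = x \<bullet> y" for x y
    by (simp add: inner_vec_def)
  with lin have T: "orthogonal_transformation T"
    by (simp add: orthogonal_transformation_def)
  define J where "J i = {j. b j \<in> B i}" for i
  have disj: "disjoint_family_on J I"
    unfolding disjoint_family_on_def
  proof safe
    fix i i' j assume *: "i \<in> I" "i' \<in> I" "i \<noteq> i'" "j \<in> J i" "j \<in> J i'"
    then have "b j \<bullet> b j = 0"
      using B(1) by (intro orth[of i i']) (auto simp: J_def)
    then show "j \<in> {}" by (simp add: b(3))
  qed
  \<comment> \<open>\<open>R i\<close> rebuilds a vector from its coordinates in \<open>J i\<close>, with zeros elsewhere.\<close>
  define R where "R i g = (\<chi> j. if j \<in> J i then g j else 0)" for i and g :: "'n \<Rightarrow> real"
  have [measurable]: "R i \<in> measurable (\<Pi>\<^sub>M j\<in>J i. borel) borel" for i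
  proof -
    have "R i = (\<lambda>g. \<Sum>j\<in>J i. axis j (g j))"
      by (simp add: R_def vec_eq_iff axis_def fun_eq_iff)
    moreover have "(\<lambda>g. axis j (g j) :: real ^ 'n) \<in> measurable (\<Pi>\<^sub>M j\<in>J i. borel) borel" if "j \<in> J i" for j
    proof -
      have *: "(\<lambda>y::real. axis j y :: real ^ 'n) \<in> borel_measurable borel"
      proof (intro borel_measurable_continuous_onI linear_continuous_on)
        have "linear (\<lambda>y::real. axis j y :: real ^ 'n)"
          by (rule linearI) (auto simp: axis_def vec_eq_iff)
        then show "bounded_linear (\<lambda>y::real. axis j y :: real ^ 'n)"
          by (simp add: linear_conv_bounded_linear)
      qed
      show ?thesis
        by (rule measurable_compose[OF measurable_component_singleton[OF that] *])
    qed
    ultimately show ?thesis by (simp add: borel_measurable_sum)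
  qed
  have FT: "F i (T (R i (restrict (\<lambda>j. x $ j) (J i)))) = F i (T x)" if i: "i \<in> I" for i x
  proof -
    let ?r = "R i (restrict (\<lambda>j. x $ j) (J i))"
    have d: "T x - T ?r = (\<Sum>j\<in>UNIV. (if j \<in> J i then 0 else x $ j) *\<^sub>R b j)"
      unfolding T_def sum_subtractf[symmetric] by (intro sum.cong) (auto simp: R_def)
    have "orthogonal (T x - T ?r) v" if "v \<in> B i" for v
    proof -
      have "v \<in> S" using that i by (auto simp: S_def)
      then obtain j0 where "v = b j0" using b(1) by auto
      moreover from this have "j0 \<in> J i" using that by (simp add: J_def)
      ultimately show ?thesis
        unfolding d by (simp add: orthogonal_def inner_sum_left b(3) mult_delta_right)
    qed
    then have "orthogonal (T x - T ?r) v" if "v \<in> V i" for v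
      using that B(4)[OF i] by (intro orthogonal_to_span[of v "B i"]) auto
    then have "F i (T ?r + (T x - T ?r)) = F i (T ?r)"
      by (intro inv[OF i]) (simp add: orthogonal_def)
    then show ?thesis by simp
  qed
  have "G.indep_vars (\<lambda>i. PiM (J i) (\<lambda>_. borel)) (\<lambda>i x. restrict (\<lambda>j. x $ j) (J i)) I"
    by (rule G.indep_vars_restrict[OF indep_vars_coordinates _ disj]) simp
  then have "G.indep_vars (\<lambda>_. borel) (\<lambda>i x. F i (T (R i (restrict (\<lambda>j. x $ j) (J i))))) I"
    by (rule G.indep_vars_compose2) measurable
  then have ind: "G.indep_vars (\<lambda>_. borel) (\<lambda>i x. F i (T x)) I"
    by (subst (asm) G.indep_vars_cong[OF refl _ refl]) (auto simp: FT)
  show ?thesis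
  proof (cases "I = {}")
    case True
    then show ?thesis by (simp add: G.indep_vars_def G.indep_sets_def)
  next
    case False
    have m [measurable]: "(\<lambda>x. \<lambda>i\<in>I. F i x) \<in> measurable borel (\<Pi>\<^sub>M i\<in>I. borel)"
      by (intro measurable_restrict F)
    have "distr gauss_measure (\<Pi>\<^sub>M i\<in>I. borel) (\<lambda>x. \<lambda>i\<in>I. F i x)
        = distr (distr gauss_measure borel T) (\<Pi>\<^sub>M i\<in>I. borel) (\<lambda>x. \<lambda>i\<in>I. F i x)"
      by (simp add: gauss_distr_orthogonal[OF T])
    also have "\<dots> = distr gauss_measure (\<Pi>\<^sub>M i\<in>I. borel) (\<lambda>x. \<lambda>i\<in>I. F i (T x))"
      by (subst distr_distr) (auto simp: comp_def)
    also have "\<dots> = (\<Pi>\<^sub>M i\<in>I. distr gauss_measure borel (\<lambda>x. F i (T x)))"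
      using ind False by (subst (asm) G.indep_vars_iff_distr_eq_PiM') auto
    also have "\<dots> = (\<Pi>\<^sub>M i\<in>I. distr gauss_measure borel (F i))"
    proof (rule PiM_cong[OF refl])
      fix i assume [simp]: "i \<in> I"
      have "distr gauss_measure borel (\<lambda>x. F i (T x)) = distr (distr gauss_measure borel T) borel (F i)"
        by (subst distr_distr) (auto simp: comp_def)
      then show "distr gauss_measure borel (\<lambda>x. F i (T x)) = distr gauss_measure borel (F i)"
        by (simp add: gauss_distr_orthogonal[OF T])
    qed
    finally show ?thesis
      using False by (subst G.indep_vars_iff_distr_eq_PiM') auto
  qed
qed


section \<open>The Fischer norm and Bombieri's inequality\<close>

definition multi_indices :: "nat \<Rightarrow> ('n::finite \<Rightarrow> nat) set" where
  "multi_indices k = {a. (\<Sum>j\<in>UNIV. a j) = k}"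

definition multi_fact :: "('n::finite \<Rightarrow> nat) \<Rightarrow> real" where
  "multi_fact a = (\<Prod>j\<in>UNIV. fact (a j))"

text \<open>A function on multi-indices of weight \<open>k\<close> is read as the coefficients of a homogeneous polynomial
  \<open>P = \<Sum>\<^sub>a \<alpha>(a) x\<^sup>a\<close>; the following is \<open>P(\<partial>) P\<close>, the squared norm for the Fischer inner product
  \<open>\<langle>P, Q\<rangle> = P(\<partial>) Q\<close>. It is \<open>k!\<close> times the square of Bombieri's norm.\<close>

definition fischer_norm2 :: "nat \<Rightarrow> (('n::finite \<Rightarrow> nat) \<Rightarrow> real) \<Rightarrow> real" where
  "fischer_norm2 k \<alpha> = (\<Sum>a\<in>multi_indices k. multi_fact a * (\<alpha> a)\<^sup>2)"

text \<open>The coefficients of the product of two homogeneous polynomials.\<close>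

definition form_mult :: "nat \<Rightarrow> nat \<Rightarrow> (('n::finite \<Rightarrow> nat) \<Rightarrow> real) \<Rightarrow> (('n \<Rightarrow> nat) \<Rightarrow> real) \<Rightarrow> ('n \<Rightarrow> nat) \<Rightarrow> real" where
  "form_mult k l \<alpha> \<beta> c = (\<Sum>a\<in>multi_indices k. \<Sum>b\<in>multi_indices l.
     if (\<lambda>j. a j + b j) = c then \<alpha> a * \<beta> b else 0)"

lemma finite_multi_indices_degree [simp]: "finite (multi_indices k)"
  unfolding multi_indices_def by (rule finite_multi_indices)

lemma multi_fact_pos [simp]: "multi_fact a > 0"
  by (simp add: multi_fact_def prod_pos)

lemma multi_fact_nonzero [simp]: "multi_fact a \<noteq> 0"
  using multi_fact_pos[of a] by linarith

lemma multi_indices_0: "multi_indices 0 = {\<lambda>_. 0}"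
  by (auto simp: multi_indices_def)

lemma multi_indices_add: "a \<in> multi_indices k \<Longrightarrow> b \<in> multi_indices l \<Longrightarrow> (\<lambda>j. a j + b j) \<in> multi_indices (k + l)"
  by (auto simp: multi_indices_def sum.distrib)

text \<open>The two-by-two contingency tables with rows \<open>p, q\<close> and \<open>r, s\<close>, row sums \<open>a\<close>, \<open>b\<close> and column sums
  \<open>a'\<close>, \<open>b'\<close>.\<close>

definition tables :: "nat \<Rightarrow> nat \<Rightarrow> nat \<Rightarrow> nat \<Rightarrow> (nat \<times> nat \<times> nat \<times> nat) set" where
  "tables a b a' b' = {(p, q, r, s). p + q = a \<and> r + s = b \<and> p + r = a' \<and> q + s = b'}"

lemma finite_tables [simp]: "finite (tables a b a' b')"
proof (rule finite_subset)
  show "tables a b a' b' \<subseteq> {..a} \<times> {..a} \<times> {..b} \<times> {..b}"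
    by (auto simp: tables_def)
qed auto

text \<open>A table is determined by its entry \<open>p\<close>, and after multiplication by \<open>a! b!\<close> its weight is a product
  of two binomial coefficients; this is Vandermonde's convolution.\<close>

lemma sum_tables:
  assumes eq: "a + b = a' + b'"
  shows "(\<Sum>(p, q, r, s)\<in>tables a b a' b'. 1 / (fact p * fact q * fact r * fact s :: real))
    = fact (a + b) / (fact a * fact b * fact a' * fact b')"
proof -
  define D where "D = {p. p \<le> a' \<and> p \<le> a \<and> a' - p \<le> b}"
  have "(\<Sum>(p, q, r, s)\<in>tables a b a' b'. 1 / (fact p * fact q * fact r * fact s :: real))
      = (\<Sum>p\<in>D. real (a choose p) * real (b choose (a' - p)) / (fact a * fact b))"
    by (rule sum.reindex_bij_witness[of _ "\<lambda>p. (p, a - p, a' - p, b - (a' - p))" fst])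
       (use eq in \<open>auto simp: tables_def D_def binomial_fact\<close>)
  also have "\<dots> = (\<Sum>p\<le>a'. real (a choose p) * real (b choose (a' - p)) / (fact a * fact b))"
    by (rule sum.mono_neutral_left) (auto simp: D_def)
  also have "\<dots> = real (\<Sum>p\<le>a'. (a choose p) * (b choose (a' - p))) / (fact a * fact b)"
    by (simp add: sum_divide_distrib)
  also have "\<dots> = real ((a + b) choose a') / (fact a * fact b)"
    by (simp add: vandermonde)
  also have "\<dots> = fact (a + b) / (fact a * fact b * fact a' * fact b')"
    using eq by (simp add: binomial_fact)
  finally show ?thesis .
qed

definition multi_tables ::
  "('n \<Rightarrow> nat) \<Rightarrow> ('n \<Rightarrow> nat) \<Rightarrow> ('n \<Rightarrow> nat) \<Rightarrow> ('n \<Rightarrow> nat) \<Rightarrow> (('n \<Rightarrow> nat) \<times> ('n \<Rightarrow> nat) \<times> ('n \<Rightarrow> nat) \<times> ('n \<Rightarrow> nat)) set" where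
  "multi_tables a b a' b' = {(p, q, r, s). (\<lambda>j. p j + q j) = a \<and> (\<lambda>j. r j + s j) = b \<and>
     (\<lambda>j. p j + r j) = a' \<and> (\<lambda>j. q j + s j) = b'}"

text \<open>The weight of a table of multi-indices is a product over the coordinates, so the sum factors.\<close>

lemma sum_multi_tables:
  fixes a b a' b' :: "'n::finite \<Rightarrow> nat"
  assumes eq: "(\<lambda>j. a j + b j) = (\<lambda>j. a' j + b' j)"
  shows "(\<Sum>(p, q, r, s)\<in>multi_tables a b a' b'. 1 / (multi_fact p * multi_fact q * multi_fact r * multi_fact s))
    = multi_fact (\<lambda>j. a j + b j) / (multi_fact a * multi_fact b * multi_fact a' * multi_fact b')"
proof -
  let ?w = "\<lambda>(p, q, r, s). 1 / (fact p * fact q * fact r * fact s :: real)"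
  let ?t = "\<lambda>j. tables (a j) (b j) (a' j) (b' j)"
  have "(\<Sum>(p, q, r, s)\<in>multi_tables a b a' b'. 1 / (multi_fact p * multi_fact q * multi_fact r * multi_fact s))
      = (\<Sum>g\<in>PiE UNIV ?t. \<Prod>j\<in>UNIV. ?w (g j))"
    by (rule sum.reindex_bij_witness[of _
          "\<lambda>g. (\<lambda>j. fst (g j), \<lambda>j. fst (snd (g j)), \<lambda>j. fst (snd (snd (g j))), \<lambda>j. snd (snd (snd (g j))))"
          "\<lambda>(p, q, r, s) j. (p j, q j, r j, s j)"])
       (auto simp: multi_tables_def tables_def multi_fact_def prod_dividef prod.distrib PiE_def Pi_def
          case_prod_beta)
  also have "\<dots> = (\<Prod>j\<in>UNIV. \<Sum>t\<in>?t j. ?w t)"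
    by (rule prod_sum_PiE[symmetric]) auto
  also have "\<dots> = (\<Prod>j\<in>UNIV. fact (a j + b j) / (fact (a j) * fact (b j) * fact (a' j) * fact (b' j)))"
    by (intro prod.cong refl sum_tables) (use eq in \<open>simp add: fun_eq_iff\<close>)
  finally show ?thesis
    by (simp add: multi_fact_def prod_dividef prod.distrib)
qed

text \<open>Reznick's identity. The left-hand side is the sum of \<open>(a + b)! \<alpha>(a) \<beta>(b) \<alpha>(a') \<beta>(b')\<close> over all
  \<open>a + b = a' + b'\<close>. Replacing \<open>(a + b)!\<close> by the sum over tables \<open>(p, q, r, s)\<close> with these margins
  separates \<open>q\<close> from \<open>r\<close>: for fixed \<open>p\<close> and \<open>s\<close> the sums over \<open>q\<close> and over \<open>r\<close> have the same value, which
  gives the square. Since \<open>a! \<alpha>(a)\<close> is the derivative \<open>\<partial>\<^sup>a P\<close>, the inner sum is, for \<open>|p| = k - m\<close>, the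
  derivative of order \<open>s\<close> of \<open>(\<partial>\<^sup>p P)(\<partial>) Q\<close>.\<close>

lemma fischer_norm2_form_mult:
  fixes \<alpha> \<beta> :: "('n::finite \<Rightarrow> nat) \<Rightarrow> real"
  shows "fischer_norm2 (k + l) (form_mult k l \<alpha> \<beta>) =
    (\<Sum>m\<le>min k l. \<Sum>p\<in>multi_indices (k - m). \<Sum>s\<in>multi_indices (l - m).
      (\<Sum>q\<in>multi_indices m. multi_fact (\<lambda>j. p j + q j) * \<alpha> (\<lambda>j. p j + q j) *
         (multi_fact (\<lambda>j. q j + s j) * \<beta> (\<lambda>j. q j + s j)) / multi_fact q)\<^sup>2 / (multi_fact p * multi_fact s))"
proof -
  define A where "A a = multi_fact a * \<alpha> a" for a
  define B where "B b = multi_fact b * \<beta> b" for b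
  let ?M = "multi_indices :: nat \<Rightarrow> ('n \<Rightarrow> nat) set"
  let ?P = "?M k \<times> ?M l"
  define add where "add = (\<lambda>(a, b). \<lambda>j::'n. a j + b j :: nat)"
  define f where "f = (\<lambda>(a, b). \<alpha> a * \<beta> b)"
  define w where "w = (\<lambda>(p, q, r, s). A (\<lambda>j. p j + q j) * B (\<lambda>j. r j + s j) * A (\<lambda>j. p j + r j) * B (\<lambda>j. q j + s j)
     * (1 / (multi_fact p * multi_fact q * multi_fact r * multi_fact s)))"
  define Z where "Z = {z \<in> ?P \<times> ?P. add (fst z) = add (snd z)}"
  define W where "W = {(p, q, r, s). (\<lambda>j. p j + q j) \<in> ?M k \<and> (\<lambda>j. r j + s j) \<in> ?M l \<and>
     (\<lambda>j. p j + r j) \<in> ?M k \<and> (\<lambda>j. q j + s j) \<in> ?M l}"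
  define marg where "marg = (\<lambda>(p, q, r, s). ((\<lambda>j::'n. p j + q j :: nat, \<lambda>j. r j + s j :: nat), (\<lambda>j. p j + r j :: nat, \<lambda>j. q j + s j :: nat)))"
  let ?N = "Sigma {..min k l} (\<lambda>m. (?M (k - m) \<times> ?M (l - m)) \<times> (?M m \<times> ?M m))"
  have finZ: "finite Z" unfolding Z_def by simp
  \<comment> \<open>All margins have weight \<open>k\<close> or \<open>l\<close>, which forces \<open>|q| = |r| = m\<close> and determines \<open>|p|\<close> and \<open>|s|\<close>.\<close>
  have bij: "bij_betw (\<lambda>(m, (p, s), (q, r)). (p, q, r, s)) ?N W"
    by (rule bij_betw_byWitness[of _ "\<lambda>(p, q, r, s). (\<Sum>j\<in>UNIV. q j, (p, s), (q, r))"])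
       (auto simp: W_def multi_indices_def sum.distrib)
  have finW: "finite W"
    using bij_betw_finite[OF bij] by simp
  have "form_mult k l \<alpha> \<beta> c = (\<Sum>x\<in>{x\<in>?P. add x = c}. f x)" for c
    unfolding form_mult_def sum.cartesian_product
    by (subst sum.inter_filter) (auto simp: add_def f_def intro!: sum.cong)
  then have "fischer_norm2 (k + l) (form_mult k l \<alpha> \<beta>)
      = (\<Sum>c\<in>?M (k + l). multi_fact c * ((\<Sum>x\<in>{x\<in>?P. add x = c}. f x) * (\<Sum>y\<in>{x\<in>?P. add x = c}. f y)))"
    by (simp add: fischer_norm2_def power2_eq_square)
  also have "\<dots> = (\<Sum>c\<in>?M (k + l). \<Sum>z\<in>{z\<in>Z. add (fst z) = c}. multi_fact (add (fst z)) * (f (fst z) * f (snd z)))"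
  proof (rule sum.cong[OF refl])
    fix c
    have "(\<Sum>x\<in>{x\<in>?P. add x = c}. f x) * (\<Sum>y\<in>{x\<in>?P. add x = c}. f y)
        = (\<Sum>z\<in>{x\<in>?P. add x = c} \<times> {x\<in>?P. add x = c}. f (fst z) * f (snd z))"
      by (simp add: sum_product sum.cartesian_product case_prod_beta)
    also have "{x\<in>?P. add x = c} \<times> {x\<in>?P. add x = c} = {z\<in>Z. add (fst z) = c}"
      by (auto simp: Z_def)
    finally show "multi_fact c * ((\<Sum>x\<in>{x\<in>?P. add x = c}. f x) * (\<Sum>y\<in>{x\<in>?P. add x = c}. f y))
      = (\<Sum>z\<in>{z\<in>Z. add (fst z) = c}. multi_fact (add (fst z)) * (f (fst z) * f (snd z)))"
      by (simp add: sum_distrib_left)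
  qed
  also have "\<dots> = (\<Sum>z\<in>Z. multi_fact (add (fst z)) * (f (fst z) * f (snd z)))"
    by (rule sum.group[OF finZ]) (auto simp: Z_def add_def intro: multi_indices_add)
  also have "\<dots> = (\<Sum>z\<in>Z. \<Sum>t\<in>{t\<in>W. marg t = z}. w t)"
  proof (rule sum.cong[OF refl])
    fix z assume z: "z \<in> Z"
    obtain a b a' b' where zz: "z = ((a, b), (a', b'))" by (metis surj_pair)
    have eq: "(\<lambda>j. a j + b j) = (\<lambda>j. a' j + b' j)" using z by (simp add: Z_def zz add_def)
    have "{t\<in>W. marg t = z} = multi_tables a b a' b'"
      using z by (auto simp: W_def marg_def zz multi_tables_def Z_def)
    then have "(\<Sum>t\<in>{t\<in>W. marg t = z}. w t)
        = (\<Sum>(p, q, r, s)\<in>multi_tables a b a' b'. A a * B b * A a' * B b' * (1 / (multi_fact p * multi_fact q * multi_fact r * multi_fact s)))"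
      by (auto simp: multi_tables_def w_def intro!: sum.cong)
    also have "\<dots> = A a * B b * A a' * B b' * (\<Sum>(p, q, r, s)\<in>multi_tables a b a' b'. 1 / (multi_fact p * multi_fact q * multi_fact r * multi_fact s))"
      by (simp only: sum_distrib_left) (auto intro: sum.cong)
    also have "\<dots> = multi_fact (add (fst z)) * (f (fst z) * f (snd z))"
      unfolding sum_multi_tables[OF eq] by (simp add: A_def B_def zz add_def f_def)
    finally show "multi_fact (add (fst z)) * (f (fst z) * f (snd z)) = (\<Sum>t\<in>{t\<in>W. marg t = z}. w t)" ..
  qed
  also have "\<dots> = (\<Sum>t\<in>W. w t)"
    by (rule sum.group[OF finW finZ]) (auto simp: W_def Z_def marg_def add_def fun_eq_iff)
  also have "\<dots> = (\<Sum>(m, (p, s), (q, r))\<in>?N. w (p, q, r, s))"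
    by (subst sum.reindex_bij_betw[OF bij, symmetric]) (simp add: case_prod_beta)
  also have "\<dots> = (\<Sum>m\<le>min k l. \<Sum>(p, s)\<in>?M (k - m) \<times> ?M (l - m). \<Sum>(q, r)\<in>?M m \<times> ?M m. w (p, q, r, s))"
    unfolding case_prod_beta sum.cartesian_product
    by (subst sum.Sigma) (simp_all add: case_prod_beta)
  also have "\<dots> = (\<Sum>m\<le>min k l. \<Sum>(p, s)\<in>?M (k - m) \<times> ?M (l - m).
      (\<Sum>q\<in>?M m. A (\<lambda>j. p j + q j) * B (\<lambda>j. q j + s j) / multi_fact q)\<^sup>2 / (multi_fact p * multi_fact s))"
    by (intro sum.cong refl)
       (auto simp: w_def power2_eq_square sum_product sum_divide_distrib sum.cartesian_product
          add.commute algebra_simps intro!: sum.cong)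
  finally show ?thesis
    by (simp add: A_def B_def sum.cartesian_product)
qed

lemma fischer_norm2_nonneg: "fischer_norm2 k \<alpha> \<ge> 0"
  unfolding fischer_norm2_def
  by (intro sum_nonneg mult_nonneg_nonneg zero_le_power2 less_imp_le multi_fact_pos)

text \<open>The part of Reznick's identity with \<open>m = 0\<close>, in which \<open>\<partial>\<^sup>p P\<close> is a constant, is the product of the
  norms.\<close>

lemma fischer_norm2_form_mult_split:
  fixes \<alpha> \<beta> :: "('n::finite \<Rightarrow> nat) \<Rightarrow> real"
  shows "fischer_norm2 (k + l) (form_mult k l \<alpha> \<beta>) = fischer_norm2 k \<alpha> * fischer_norm2 l \<beta> +
    (\<Sum>m\<in>{1..min k l}. \<Sum>p\<in>multi_indices (k - m). \<Sum>s\<in>multi_indices (l - m).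
      (\<Sum>q\<in>multi_indices m. multi_fact (\<lambda>j. p j + q j) * \<alpha> (\<lambda>j. p j + q j) *
         (multi_fact (\<lambda>j. q j + s j) * \<beta> (\<lambda>j. q j + s j)) / multi_fact q)\<^sup>2 / (multi_fact p * multi_fact s))"
    (is "_ = _ + (\<Sum>m\<in>_. ?g m)")
proof -
  have "(\<Sum>m\<le>min k l. ?g m) = ?g 0 + (\<Sum>m\<in>{1..min k l}. ?g m)"
    by (simp only: atMost_atLeast0 le0 sum.atLeast_Suc_atMost[of 0] One_nat_def)
  moreover have "?g 0 = fischer_norm2 k \<alpha> * fischer_norm2 l \<beta>"
    by (simp add: multi_indices_0 fischer_norm2_def sum_product power2_eq_square multi_fact_def[of "\<lambda>_. 0"])
       (simp add: field_simps)
  ultimately show ?thesis by (simp only: fischer_norm2_form_mult)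
qed

lemma fischer_norm2_form_mult_ge:
  fixes \<alpha> \<beta> :: "('n::finite \<Rightarrow> nat) \<Rightarrow> real"
  shows "fischer_norm2 k \<alpha> * fischer_norm2 l \<beta> \<le> fischer_norm2 (k + l) (form_mult k l \<alpha> \<beta>)"
  unfolding fischer_norm2_form_mult_split
  by (auto intro!: sum_nonneg divide_nonneg_pos)

lemma multi_indices_1: "multi_indices 1 = range (\<lambda>i j :: 'n::finite. if j = i then 1 else 0)"
proof (intro set_eqI iffI)
  fix a :: "'n \<Rightarrow> nat" assume "a \<in> multi_indices 1"
  then have s: "(\<Sum>j\<in>UNIV. a j) = 1" by (simp add: multi_indices_def)
  then obtain i where i: "a i \<noteq> 0" by fastforce
  have "a i + (\<Sum>j\<in>UNIV - {i}. a j) = 1" using s by (simp add: sum.remove[of UNIV i])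
  with i have "a i = 1" "(\<Sum>j\<in>UNIV - {i}. a j) = 0" by linarith+
  then have "a i = 1" "\<And>j. j \<noteq> i \<Longrightarrow> a j = 0" by auto
  then have "a = (\<lambda>j. if j = i then 1 else 0)" by auto
  then show "a \<in> range (\<lambda>i j. if j = i then 1 else 0)" by blast
qed (auto simp: multi_indices_def)

text \<open>Equality annihilates the squares with \<open>m = 1\<close>, in which \<open>q\<close> runs over the unit vectors and the inner
  sum is the inner product of two gradients.\<close>

lemma fischer_norm2_form_mult_eq_imp_orthogonal:
  fixes \<alpha> \<beta> :: "('n::finite \<Rightarrow> nat) \<Rightarrow> real"
  assumes le: "fischer_norm2 (k + l) (form_mult k l \<alpha> \<beta>) \<le> fischer_norm2 k \<alpha> * fischer_norm2 l \<beta>"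
    and pos: "k \<ge> 1" "l \<ge> 1"
    and p: "p \<in> multi_indices (k - 1)" and s: "s \<in> multi_indices (l - 1)"
  shows "(\<Sum>j\<in>UNIV. (multi_fact (p(j := Suc (p j))) * \<alpha> (p(j := Suc (p j)))) *
    (multi_fact (s(j := Suc (s j))) * \<beta> (s(j := Suc (s j))))) = 0"
proof -
  define h where "h m p s = (\<Sum>q\<in>multi_indices m. multi_fact (\<lambda>j. p j + q j) * \<alpha> (\<lambda>j. p j + q j) *
         (multi_fact (\<lambda>j. q j + s j) * \<beta> (\<lambda>j. q j + s j)) / multi_fact q)" for m p s
  let ?g = "\<lambda>m p s. (h m p s)\<^sup>2 / (multi_fact p * multi_fact s)"
  have "(\<Sum>m\<in>{1..min k l}. \<Sum>p\<in>multi_indices (k - m). \<Sum>s\<in>multi_indices (l - m). ?g m p s) \<le> 0"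
    using le unfolding fischer_norm2_form_mult_split h_def by simp
  moreover have g: "?g m p s \<ge> 0" for m p s by (intro divide_nonneg_pos) auto
  ultimately have "(\<Sum>m\<in>{1..min k l}. \<Sum>p\<in>multi_indices (k - m). \<Sum>s\<in>multi_indices (l - m). ?g m p s) = 0"
    by (intro antisym sum_nonneg) auto
  then have "\<forall>m\<in>{1..min k l}. (\<Sum>p\<in>multi_indices (k - m). \<Sum>s\<in>multi_indices (l - m). ?g m p s) = 0"
    by (subst (asm) sum_nonneg_eq_0_iff) (auto intro!: sum_nonneg g)
  moreover have "1 \<in> {1..min k l}" using pos by simp
  ultimately have "(\<Sum>p\<in>multi_indices (k - 1). \<Sum>s\<in>multi_indices (l - 1). ?g 1 p s) = 0" by blast
  then have "\<forall>p\<in>multi_indices (k - 1). (\<Sum>s\<in>multi_indices (l - 1). ?g 1 p s) = 0"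
    by (subst (asm) sum_nonneg_eq_0_iff) (auto intro!: sum_nonneg g)
  then have "(\<Sum>s\<in>multi_indices (l - 1). ?g 1 p s) = 0" using p by blast
  then have "\<forall>s\<in>multi_indices (l - 1). ?g 1 p s = 0"
    by (subst (asm) sum_nonneg_eq_0_iff) (auto intro!: g)
  then have "h 1 p s = 0" using s by auto
  moreover have "h 1 p s = (\<Sum>j\<in>UNIV. (multi_fact (p(j := Suc (p j))) * \<alpha> (p(j := Suc (p j)))) *
    (multi_fact (s(j := Suc (s j))) * \<beta> (s(j := Suc (s j)))))"
  proof -
    have inj: "inj (\<lambda>i j :: 'n. if j = i then 1 else 0 :: nat)"
      by (rule injI) (metis zero_neq_one)
    have *: "(\<lambda>j. t j + (if j = i then 1 else 0)) = t(i := Suc (t i))"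
       "(\<lambda>j. (if j = i then 1 else 0) + t j) = t(i := Suc (t i))" for t :: "'n \<Rightarrow> nat" and i
      by auto
    have **: "multi_fact (\<lambda>j :: 'n. if j = i then 1 else 0) = 1" for i
      by (auto simp: multi_fact_def intro!: prod.neutral)
    show ?thesis
      unfolding h_def multi_indices_1 sum.reindex[OF inj] comp_def * ** by simp
  qed
  ultimately show ?thesis by simp
qed


section \<open>Products of chaos elements\<close>

definition hermite_form :: "nat \<Rightarrow> (('n::finite \<Rightarrow> nat) \<Rightarrow> real) \<Rightarrow> real ^ 'n \<Rightarrow> real" where
  "hermite_form k \<alpha> x = (\<Sum>a\<in>multi_indices k. \<alpha> a * hermite_prod a x)"

lemma real_polynomial_function_hermite_form: "real_polynomial_function (hermite_form k \<alpha>)"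
proof -
  have "real_polynomial_function (\<lambda>x. \<alpha> a * hermite_prod a x)" for a
    by (rule real_polynomial_function.intros(4)[OF real_polynomial_function.intros(2)
          real_polynomial_function_hermite_prod])
  then show ?thesis
    unfolding hermite_form_def[abs_def] by (rule real_polynomial_function_sum[OF finite_multi_indices_degree])
qed

lemma real_polynomial_function_mult:
  "real_polynomial_function f \<Longrightarrow> real_polynomial_function g \<Longrightarrow> real_polynomial_function (\<lambda>x. f x * g x)"
  by (rule real_polynomial_function.intros(4))

text \<open>The integral factors over the coordinates. If \<open>c\<close> is not the sum of the \<open>\<phi> i\<close>, then, both having
  the same weight, \<open>c\<close> exceeds that sum in some coordinate, where the factor vanishes for reasons of
  degree. Otherwise every factor is \<open>(c j)!\<close>, because products of Hermite polynomials are monic.\<close>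

lemma gauss_integral_hermite_products:
  fixes \<phi> :: "'i \<Rightarrow> 'n::finite \<Rightarrow> nat"
  assumes S: "finite S" and \<phi>: "\<And>i. i \<in> S \<Longrightarrow> \<phi> i \<in> multi_indices (k i)"
    and c: "c \<in> multi_indices (\<Sum>i\<in>S. k i)"
  shows "(\<integral>x. (\<Prod>i\<in>S. hermite_prod (\<phi> i) x) * hermite_prod c x \<partial>gauss_measure)
    = (if (\<lambda>j. \<Sum>i\<in>S. \<phi> i j) = c then multi_fact c else 0)"
proof -
  let ?q = "\<lambda>j. \<Prod>i\<in>S. hermite (\<phi> i j)"
  let ?a = "\<lambda>j. \<Sum>i\<in>S. \<phi> i j"
  note q = degree_prod_hermite_monic[OF S]
  have "(\<Prod>i\<in>S. hermite_prod (\<phi> i) x) * hermite_prod c x = (\<Prod>j\<in>UNIV. poly (hermite (c j) * ?q j) (x $ j))" for x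
    unfolding hermite_prod_def
    by (subst prod.swap) (simp add: poly_prod prod.distrib mult.commute)
  then have eq: "(\<integral>x. (\<Prod>i\<in>S. hermite_prod (\<phi> i) x) * hermite_prod c x \<partial>gauss_measure)
      = (\<Prod>j\<in>UNIV. normal_expect (hermite (c j) * ?q j))"
    by (simp only: gauss_integral_prod_poly)
  show ?thesis
  proof (cases "?a = c")
    case True
    then have "normal_expect (hermite (c j) * ?q j) = fact (c j)" for j
      using q[of "\<lambda>i. \<phi> i j"] by (subst hermite_normal_expect_le) (auto simp: fun_eq_iff)
    with True show ?thesis by (simp add: eq multi_fact_def)
  next
    case False
    have "(\<Sum>j\<in>UNIV. ?a j) = (\<Sum>j\<in>UNIV. c j)"
      using \<phi> c by (subst sum.swap) (auto simp: multi_indices_def)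
    moreover have "(\<Sum>j\<in>UNIV. c j) < (\<Sum>j\<in>UNIV. ?a j)" if "\<forall>j. c j \<le> ?a j"
    proof (rule sum_strict_mono_ex1)
      obtain j where "?a j \<noteq> c j" using False by auto
      with that have "c j < ?a j" by (simp add: order_less_le)
      then show "\<exists>j\<in>UNIV. c j < ?a j" by blast
    qed (use that in auto)
    ultimately have "\<exists>j. ?a j < c j"
      by (metis less_irrefl not_le)
    then obtain j where j: "?a j < c j" ..
    then have "normal_expect (hermite (c j) * ?q j) = 0"
      using q[of "\<lambda>i. \<phi> i j"] by (subst hermite_normal_expect_le) (auto simp: coeff_eq_0)
    then have "(\<Prod>j\<in>UNIV. normal_expect (hermite (c j) * ?q j)) = 0"
      by (auto simp: prod_zero_iff)
    with False show ?thesis by (simp add: eq)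
  qed
qed

text \<open>The coefficients of the product over \<open>S\<close> of the homogeneous polynomials with coefficients \<open>\<alpha> i\<close>.
  Summing over all choices of one multi-index per factor makes it visibly independent of the order of
  the factors, so that any pair of them can be multiplied first.\<close>

definition product_coeff :: "'i set \<Rightarrow> ('i \<Rightarrow> nat) \<Rightarrow> ('i \<Rightarrow> ('n::finite \<Rightarrow> nat) \<Rightarrow> real) \<Rightarrow> ('n \<Rightarrow> nat) \<Rightarrow> real" where
  "product_coeff S k \<alpha> c = (\<Sum>\<phi>\<in>PiE S (\<lambda>i. multi_indices (k i)).
     if (\<lambda>j. \<Sum>i\<in>S. \<phi> i j) = c then \<Prod>i\<in>S. \<alpha> i (\<phi> i) else 0)"

lemma gauss_integral_product_hermite:
  assumes S: "finite S" and c: "c \<in> multi_indices (\<Sum>i\<in>S. k i)"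
  shows "(\<integral>x. (\<Prod>i\<in>S. hermite_form (k i) (\<alpha> i) x) * hermite_prod c x \<partial>gauss_measure)
    = multi_fact c * product_coeff S k \<alpha> c"
proof -
  let ?\<Phi> = "PiE S (\<lambda>i. multi_indices (k i))"
  have "finite ?\<Phi>" using S by (intro finite_PiE) auto
  have "(\<Prod>i\<in>S. hermite_form (k i) (\<alpha> i) x) * hermite_prod c x
      = (\<Sum>\<phi>\<in>?\<Phi>. (\<Prod>i\<in>S. \<alpha> i (\<phi> i)) * ((\<Prod>i\<in>S. hermite_prod (\<phi> i) x) * hermite_prod c x))" for x
    unfolding hermite_form_def
    by (subst prod_sum_PiE[OF S]) (simp_all add: sum_distrib_right prod.distrib mult.assoc)
  moreover have "integrable gauss_measure (\<lambda>x. (\<Prod>i\<in>S. hermite_prod (\<phi> i) x) * hermite_prod c x)" for \<phi> :: "_ \<Rightarrow> 'b \<Rightarrow> nat"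
    by (intro gauss_integrable_polynomial real_polynomial_function_mult real_polynomial_function_prod S
        real_polynomial_function_hermite_prod)
  ultimately have "(\<integral>x. (\<Prod>i\<in>S. hermite_form (k i) (\<alpha> i) x) * hermite_prod c x \<partial>gauss_measure)
      = (\<Sum>\<phi>\<in>?\<Phi>. (\<Prod>i\<in>S. \<alpha> i (\<phi> i)) *
           (\<integral>x. (\<Prod>i\<in>S. hermite_prod (\<phi> i) x) * hermite_prod c x \<partial>gauss_measure))"
    by simp
  also have "\<dots> = (\<Sum>\<phi>\<in>?\<Phi>. (\<Prod>i\<in>S. \<alpha> i (\<phi> i)) *
      (if (\<lambda>j. \<Sum>i\<in>S. \<phi> i j) = c then multi_fact c else 0))"
    using c by (intro sum.cong refl, subst gauss_integral_hermite_products[OF S, where k = k]) auto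
  also have "\<dots> = multi_fact c * product_coeff S k \<alpha> c"
    unfolding product_coeff_def sum_distrib_left by (intro sum.cong) auto
  finally show ?thesis .
qed

lemma gauss_integral_hermite_form_hermite_prod:
  assumes "c \<in> multi_indices k"
  shows "(\<integral>x. hermite_form k \<alpha> x * hermite_prod c x \<partial>gauss_measure) = multi_fact c * \<alpha> c"
proof -
  have int: "integrable gauss_measure (\<lambda>x. hermite_prod a x * hermite_prod c x)" for a
    by (intro gauss_integrable_polynomial real_polynomial_function_mult real_polynomial_function_hermite_prod)
  have "(\<integral>x. hermite_form k \<alpha> x * hermite_prod c x \<partial>gauss_measure)
      = (\<Sum>a\<in>multi_indices k. \<alpha> a * (\<integral>x. hermite_prod a x * hermite_prod c x \<partial>gauss_measure))"
    using int by (simp add: hermite_form_def sum_distrib_right mult.assoc)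
  also have "\<dots> = (\<Sum>a\<in>multi_indices k. \<alpha> a * (if a = c then multi_fact c else 0))"
    using gauss_integral_hermite_products[of "{()}" "\<lambda>_. _" "\<lambda>_. k" c] assms by (intro sum.cong) auto
  also have "\<dots> = multi_fact c * \<alpha> c"
    using assms by (simp add: mult_delta_right sum.delta)
  finally show ?thesis .
qed

lemma gauss_integral_mult_hermite_form:
  assumes f: "real_polynomial_function f"
  shows "(\<integral>x. f x * hermite_form k \<alpha> x \<partial>gauss_measure)
    = (\<Sum>a\<in>multi_indices k. \<alpha> a * (\<integral>x. f x * hermite_prod a x \<partial>gauss_measure))"
proof -
  have int: "integrable gauss_measure (\<lambda>x. f x * hermite_prod a x)" for a
    by (intro gauss_integrable_polynomial real_polynomial_function_mult f real_polynomial_function_hermite_prod)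
  have "f x * hermite_form k \<alpha> x = (\<Sum>a\<in>multi_indices k. \<alpha> a * (f x * hermite_prod a x))" for x
    by (simp add: hermite_form_def sum_distrib_left mult.left_commute)
  then show ?thesis using int by simp
qed

lemma gauss_integral_hermite_form_square:
  "(\<integral>x. (hermite_form k \<alpha> x)\<^sup>2 \<partial>gauss_measure) = fischer_norm2 k \<alpha>"
  unfolding power2_eq_square gauss_integral_mult_hermite_form[OF real_polynomial_function_hermite_form]
  by (simp add: gauss_integral_hermite_form_hermite_prod fischer_norm2_def power2_eq_square mult.left_commute)

text \<open>The form with coefficients \<open>\<beta>\<close> is the projection of \<open>f\<close> to the chaos of order \<open>k\<close>.\<close>

lemma hermite_bessel_inequality:
  assumes f: "real_polynomial_function f"
    and \<beta>: "\<And>c. c \<in> multi_indices k \<Longrightarrow> (\<integral>x. f x * hermite_prod c x \<partial>gauss_measure) = multi_fact c * \<beta> c"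
  shows "fischer_norm2 k \<beta> \<le> (\<integral>x. (f x)\<^sup>2 \<partial>gauss_measure)"
proof -
  let ?g = "hermite_form k \<beta>"
  note g = real_polynomial_function_hermite_form[of k \<beta>]
  have int: "integrable gauss_measure (\<lambda>x. f x * f x)" "integrable gauss_measure (\<lambda>x. f x * ?g x)"
     "integrable gauss_measure (\<lambda>x. ?g x * ?g x)"
    by (intro gauss_integrable_polynomial real_polynomial_function_mult f g)+
  have "(\<integral>x. f x * ?g x \<partial>gauss_measure) = fischer_norm2 k \<beta>"
    unfolding gauss_integral_mult_hermite_form[OF f] fischer_norm2_def
    by (intro sum.cong) (auto simp: \<beta> power2_eq_square)
  moreover have "(\<integral>x. ?g x * ?g x \<partial>gauss_measure) = fischer_norm2 k \<beta>"
    using gauss_integral_hermite_form_square[of k \<beta>] by (simp add: power2_eq_square)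
  moreover have "0 \<le> (\<integral>x. f x * f x - 2 * (f x * ?g x) + ?g x * ?g x \<partial>gauss_measure)"
  proof (rule Bochner_Integration.integral_nonneg)
    fix x
    have "f x * f x - 2 * (f x * ?g x) + ?g x * ?g x = (f x - ?g x)\<^sup>2"
      by (simp add: power2_eq_square algebra_simps)
    then show "0 \<le> f x * f x - 2 * (f x * ?g x) + ?g x * ?g x" by simp
  qed
  ultimately show ?thesis
    using int by (simp add: power2_eq_square)
qed

lemma fischer_norm2_product_coeff_le:
  assumes "finite S"
  shows "fischer_norm2 (\<Sum>i\<in>S. k i) (product_coeff S k \<alpha>)
    \<le> (\<integral>x. (\<Prod>i\<in>S. (hermite_form (k i) (\<alpha> i) x)\<^sup>2) \<partial>gauss_measure)"
  unfolding prod_power_distrib[symmetric]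
  by (intro hermite_bessel_inequality gauss_integral_product_hermite real_polynomial_function_prod
      real_polynomial_function_hermite_form assms)

lemma product_coeff_empty: "product_coeff {} k \<alpha> c = (if (\<lambda>_. 0) = c then 1 else 0)"
  by (simp add: product_coeff_def)

lemma product_coeff_insert:
  assumes S: "finite S" "i \<notin> S"
  shows "product_coeff (insert i S) k \<alpha> = form_mult (k i) (\<Sum>i\<in>S. k i) (\<alpha> i) (product_coeff S k \<alpha>)"
proof
  fix c
  let ?M = "multi_indices :: nat \<Rightarrow> ('b \<Rightarrow> nat) set"
  let ?\<Phi> = "PiE S (\<lambda>i. ?M (k i))"
  let ?sum = "\<lambda>\<phi> j. \<Sum>i\<in>S. \<phi> i j"
  have fin: "finite ?\<Phi>" using S by (intro finite_PiE) auto
  have upd: "(\<Sum>l\<in>S. (\<phi>(i := a)) l j) = ?sum \<phi> j" "(\<Prod>l\<in>S. \<alpha> l ((\<phi>(i := a)) l)) = (\<Prod>l\<in>S. \<alpha> l (\<phi> l))" for \<phi> a j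
    using S(2) by (auto intro!: sum.cong prod.cong)
  have "product_coeff (insert i S) k \<alpha> c
      = (\<Sum>(a, \<phi>)\<in>?M (k i) \<times> ?\<Phi>. if (\<lambda>j. a j + ?sum \<phi> j) = c then \<alpha> i a * (\<Prod>l\<in>S. \<alpha> l (\<phi> l)) else 0)"
  proof -
    have "product_coeff (insert i S) k \<alpha> c
        = (\<Sum>(a, \<phi>)\<in>?M (k i) \<times> ?\<Phi>. if (\<lambda>j. \<Sum>l\<in>insert i S. (\<phi>(i := a)) l j) = c
             then \<Prod>l\<in>insert i S. \<alpha> l ((\<phi>(i := a)) l) else 0)"
      unfolding product_coeff_def PiE_insert_eq
      by (subst sum.reindex[OF inj_combinator[OF S(2)]]) (auto simp: comp_def intro!: sum.cong)
    then show ?thesis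
      by (simp only: sum.insert[OF S] prod.insert[OF S] upd fun_upd_same)
  qed
  also have "\<dots> = (\<Sum>a\<in>?M (k i). \<Sum>\<phi>\<in>?\<Phi>. if (\<lambda>j. a j + ?sum \<phi> j) = c then \<alpha> i a * (\<Prod>l\<in>S. \<alpha> l (\<phi> l)) else 0)"
    by (simp add: sum.cartesian_product)
  also have "\<dots> = (\<Sum>a\<in>?M (k i). \<Sum>b\<in>?M (\<Sum>i\<in>S. k i). \<Sum>\<phi>\<in>{\<phi>\<in>?\<Phi>. ?sum \<phi> = b}.
      if (\<lambda>j. a j + ?sum \<phi> j) = c then \<alpha> i a * (\<Prod>l\<in>S. \<alpha> l (\<phi> l)) else 0)"
  proof (rule sum.cong[OF refl], rule sum.group[symmetric, OF fin])
    show "?sum ` ?\<Phi> \<subseteq> ?M (\<Sum>i\<in>S. k i)"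
    proof safe
      fix \<phi> assume "\<phi> \<in> ?\<Phi>"
      then show "?sum \<phi> \<in> ?M (\<Sum>i\<in>S. k i)"
        unfolding multi_indices_def mem_Collect_eq
        by (subst sum.swap) (auto intro!: sum.cong)
    qed
  qed simp
  also have "\<dots> = form_mult (k i) (\<Sum>i\<in>S. k i) (\<alpha> i) (product_coeff S k \<alpha>) c"
    unfolding form_mult_def product_coeff_def sum.inter_filter[OF fin]
    by (intro sum.cong refl) (auto simp: sum_distrib_left intro!: sum.cong sum.neutral)
  finally show "product_coeff (insert i S) k \<alpha> c = \<dots>" .
qed

lemma product_coeff_singleton:
  assumes "c \<in> multi_indices (k i)"
  shows "product_coeff {i} k \<alpha> c = \<alpha> i c"
proof -
  have "product_coeff {i} k \<alpha> c = form_mult (k i) 0 (\<alpha> i) (product_coeff {} k \<alpha>) c"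
    by (subst product_coeff_insert) auto
  also have "\<dots> = (\<Sum>a\<in>multi_indices (k i). if a = c then \<alpha> i a else 0)"
    unfolding form_mult_def multi_indices_0 by (simp add: product_coeff_empty)
  finally show ?thesis using assms by (simp add: sum.delta)
qed

text \<open>Bombieri's inequality, applied to the factors in \<open>R\<close> one at a time while the product over \<open>T\<close> is kept
  as a single factor. The set \<open>T\<close> is empty for the inequality and a pair for the case of equality.\<close>

lemma fischer_norm2_product_coeff_Un:
  assumes "finite R" "finite T" "R \<inter> T = {}"
  shows "fischer_norm2 (\<Sum>i\<in>T. k i) (product_coeff T k \<alpha>) * (\<Prod>i\<in>R. fischer_norm2 (k i) (\<alpha> i))
    \<le> fischer_norm2 (\<Sum>i\<in>R \<union> T. k i) (product_coeff (R \<union> T) k \<alpha>)"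
  using assms
proof (induction R rule: finite_induct)
  case empty
  then show ?case by simp
next
  case (insert i R)
  let ?N = "fischer_norm2 (\<Sum>i\<in>R \<union> T. k i) (product_coeff (R \<union> T) k \<alpha>)"
  have i: "finite (R \<union> T)" "i \<notin> R \<union> T" using insert by auto
  have "fischer_norm2 (\<Sum>i\<in>T. k i) (product_coeff T k \<alpha>) * (\<Prod>i\<in>insert i R. fischer_norm2 (k i) (\<alpha> i))
      \<le> fischer_norm2 (k i) (\<alpha> i) * ?N"
    using insert mult_left_mono[OF insert.IH fischer_norm2_nonneg[of "k i" "\<alpha> i"]]
    by (simp add: mult.left_commute)
  also have "\<dots> \<le> fischer_norm2 (k i + (\<Sum>i\<in>R \<union> T. k i)) (product_coeff (insert i (R \<union> T)) k \<alpha>)"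
    unfolding product_coeff_insert[OF i] by (rule fischer_norm2_form_mult_ge)
  finally show ?case using i by simp
qed

lemma product_coeff_pair:
  assumes "i \<noteq> j"
  shows "product_coeff {i, j} k \<alpha> = form_mult (k i) (k j) (\<alpha> i) (\<alpha> j)"
proof
  fix c
  have "product_coeff {i, j} k \<alpha> c = form_mult (k i) (k j) (\<alpha> i) (product_coeff {j} k \<alpha>) c"
    using assms by (subst product_coeff_insert) auto
  also have "\<dots> = form_mult (k i) (k j) (\<alpha> i) (\<alpha> j) c"
    unfolding form_mult_def by (intro sum.cong refl) (auto simp: product_coeff_singleton)
  finally show "product_coeff {i, j} k \<alpha> c = form_mult (k i) (k j) (\<alpha> i) (\<alpha> j) c" .
qed

section \<open>The directions on which a chaos element depends\<close>

text \<open>For \<open>|p| = k - 1\<close> this is the gradient of the linear form \<open>\<partial>\<^sup>p P\<close>, where \<open>P = \<Sum>\<^sub>a \<alpha>(a) x\<^sup>a\<close> is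
  homogeneous of degree \<open>k\<close>.\<close>

definition form_gradient :: "(('n::finite \<Rightarrow> nat) \<Rightarrow> real) \<Rightarrow> ('n \<Rightarrow> nat) \<Rightarrow> real ^ 'n" where
  "form_gradient \<alpha> p = (\<chi> j. multi_fact (p(j := Suc (p j))) * \<alpha> (p(j := Suc (p j))))"

lemma multi_fact_Suc: "multi_fact (p(j := Suc (p j))) = real (Suc (p j)) * multi_fact p"
  by (simp add: multi_fact_def prod.remove[of UNIV j])

lemma hermite_prod_derivative_along:
  "((\<lambda>t. hermite_prod a (x + t *\<^sub>R u)) has_field_derivative
     (\<Sum>j\<in>UNIV. u $ j * (real (a j) * hermite_prod (a(j := a j - 1)) (x + t *\<^sub>R u)))) (at t)"
proof -
  let ?y = "x + t *\<^sub>R u"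
  have pd: "pderiv (hermite m) = of_nat m * hermite (m - 1)" for m
    using hermite_ode[of "m - 1"] by (cases m) auto
  have "((\<lambda>t. poly (hermite (a j)) (x $ j + t * u $ j)) has_field_derivative
      u $ j * (real (a j) * poly (hermite (a j - 1)) (?y $ j))) (at t)" for j
    by (rule derivative_eq_intros DERIV_chain2[OF poly_DERIV] refl | simp add: pd of_nat_poly mult_ac)+
  then have deriv: "((\<lambda>t. hermite_prod a (x + t *\<^sub>R u)) has_field_derivative
     (\<Sum>j\<in>UNIV. u $ j * (real (a j) * poly (hermite (a j - 1)) (?y $ j)) *
        (\<Prod>i\<in>UNIV - {j}. poly (hermite (a i)) (?y $ i)))) (at t)"
    unfolding hermite_prod_def by (intro has_field_derivative_prod[THEN DERIV_cong]) simp_all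
  have term_eq: "u $ j * (real (a j) * poly (hermite (a j - 1)) (?y $ j)) *
        (\<Prod>i\<in>UNIV - {j}. poly (hermite (a i)) (?y $ i))
      = u $ j * (real (a j) * hermite_prod (a(j := a j - 1)) ?y)" for j
    unfolding hermite_prod_split[of _ ?y j] by simp
  from deriv show ?thesis unfolding term_eq .
qed

text \<open>Since \<open>H\<^sub>m' = m H\<^sub>m\<^sub>-\<^sub>1\<close>, a directional derivative acts on Hermite expansions as it does on the
  homogeneous polynomial with the same coefficients; its coefficient at \<open>p\<close> is \<open>\<partial>\<^sub>u \<partial>\<^sup>p P / p!\<close>.\<close>

lemma hermite_form_derivative_along:
  assumes k: "k \<ge> 1"
  shows "((\<lambda>t. hermite_form k \<alpha> (x + t *\<^sub>R u)) has_field_derivative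
     (\<Sum>p\<in>multi_indices (k - 1). (u \<bullet> form_gradient \<alpha> p) / multi_fact p * hermite_prod p (x + t *\<^sub>R u))) (at t)"
proof -
  let ?y = "x + t *\<^sub>R u"
  have "((\<lambda>t. hermite_form k \<alpha> (x + t *\<^sub>R u)) has_field_derivative
     (\<Sum>a\<in>multi_indices k. \<alpha> a * (\<Sum>j\<in>UNIV. u $ j * (real (a j) * hermite_prod (a(j := a j - 1)) ?y)))) (at t)"
    unfolding hermite_form_def by (intro DERIV_sum DERIV_cmult hermite_prod_derivative_along)
  also have "(\<Sum>a\<in>multi_indices k. \<alpha> a * (\<Sum>j\<in>UNIV. u $ j * (real (a j) * hermite_prod (a(j := a j - 1)) ?y)))
      = (\<Sum>j\<in>UNIV. \<Sum>a\<in>multi_indices k. u $ j * (\<alpha> a * real (a j) * hermite_prod (a(j := a j - 1)) ?y))"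
    unfolding sum_distrib_left by (subst sum.swap) (simp add: mult_ac)
  also have "\<dots> = (\<Sum>j\<in>UNIV. \<Sum>p\<in>multi_indices (k - 1). u $ j * (\<alpha> (p(j := Suc (p j))) * real (Suc (p j)) * hermite_prod p ?y))"
  proof (rule sum.cong[OF refl])
    fix j
    have "(\<Sum>a\<in>multi_indices k. u $ j * (\<alpha> a * real (a j) * hermite_prod (a(j := a j - 1)) ?y))
        = (\<Sum>a\<in>{a\<in>multi_indices k. a j \<noteq> 0}. u $ j * (\<alpha> a * real (a j) * hermite_prod (a(j := a j - 1)) ?y))"
      by (rule sum.mono_neutral_right) auto
    also have "\<dots> = (\<Sum>p\<in>multi_indices (k - 1). u $ j * (\<alpha> (p(j := Suc (p j))) * real (Suc (p j)) * hermite_prod p ?y))"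
      by (rule sum.reindex_bij_witness[of _ "\<lambda>p. p(j := Suc (p j))" "\<lambda>a. a(j := a j - 1)"])
         (use k in \<open>auto simp: multi_indices_def sum.remove[of UNIV j]\<close>)
    finally show "(\<Sum>a\<in>multi_indices k. u $ j * (\<alpha> a * real (a j) * hermite_prod (a(j := a j - 1)) ?y)) = \<dots>" .
  qed
  also have "\<dots> = (\<Sum>p\<in>multi_indices (k - 1). (u \<bullet> form_gradient \<alpha> p) / multi_fact p * hermite_prod p ?y)"
    by (subst sum.swap)
       (simp add: inner_vec_def form_gradient_def multi_fact_Suc sum_divide_distrib sum_distrib_left sum_distrib_right mult_ac)
  finally show ?thesis .
qed

lemma hermite_form_translate:
  assumes k: "k \<ge> 1" and u: "\<And>p. p \<in> multi_indices (k - 1) \<Longrightarrow> u \<bullet> form_gradient \<alpha> p = 0"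
  shows "hermite_form k \<alpha> (x + u) = hermite_form k \<alpha> x"
proof -
  have "((\<lambda>t. hermite_form k \<alpha> (x + t *\<^sub>R u)) has_field_derivative 0) (at t)" for t
    using hermite_form_derivative_along[OF k, of \<alpha> x u t] u by simp
  then have "hermite_form k \<alpha> (x + 1 *\<^sub>R u) = hermite_form k \<alpha> (x + 0 *\<^sub>R u)"
    by (intro DERIV_isconst_all[of "\<lambda>t. hermite_form k \<alpha> (x + t *\<^sub>R u)"]) simp
  then show ?thesis by simp
qed

text \<open>Equality for all factors implies equality for the pair \<open>i, j\<close>: the bound that multiplies this pair
  first leaves the positive norms of the other factors on both sides.\<close>

lemma product_equality_imp_orthogonal_gradients:
  assumes I: "finite I" and ij: "i \<in> I" "j \<in> I" "i \<noteq> j"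
    and k: "k i \<ge> 1" "k j \<ge> 1"
    and eq: "(\<integral>x. (\<Prod>l\<in>I. (hermite_form (k l) (\<alpha> l) x)\<^sup>2) \<partial>gauss_measure)
      \<le> (\<Prod>l\<in>I. fischer_norm2 (k l) (\<alpha> l))"
    and pos: "\<And>l. l \<in> I - {i, j} \<Longrightarrow> fischer_norm2 (k l) (\<alpha> l) > 0"
    and p: "p \<in> multi_indices (k i - 1)" and s: "s \<in> multi_indices (k j - 1)"
  shows "form_gradient (\<alpha> i) p \<bullet> form_gradient (\<alpha> j) s = 0"
proof -
  let ?n = "\<lambda>l. fischer_norm2 (k l) (\<alpha> l)"
  let ?R = "\<Prod>l\<in>I - {i, j}. ?n l"
  have un: "(I - {i, j}) \<union> {i, j} = I" using ij by auto
  have "fischer_norm2 (k i + k j) (product_coeff {i, j} k \<alpha>) * ?R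
      \<le> (\<integral>x. (\<Prod>l\<in>I. (hermite_form (k l) (\<alpha> l) x)\<^sup>2) \<partial>gauss_measure)"
    using fischer_norm2_product_coeff_Un[of "I - {i, j}" "{i, j}" k \<alpha>]
      fischer_norm2_product_coeff_le[OF I, of k \<alpha>] I ij(3) unfolding un by simp
  also have "\<dots> \<le> (\<Prod>l\<in>I. ?n l)" by (rule eq)
  also have "\<dots> = (?n i * ?n j) * ?R"
    using I ij by (subst un[symmetric], subst prod.union_disjoint) (auto simp: mult_ac)
  finally have "fischer_norm2 (k i + k j) (product_coeff {i, j} k \<alpha>) * ?R \<le> (?n i * ?n j) * ?R" .
  moreover have "?R > 0" using pos by (intro prod_pos) auto
  ultimately have "fischer_norm2 (k i + k j) (product_coeff {i, j} k \<alpha>) \<le> ?n i * ?n j"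
    by simp
  from fischer_norm2_form_mult_eq_imp_orthogonal[OF this[unfolded product_coeff_pair[OF ij(3)]] k p s]
  show ?thesis by (simp add: inner_vec_def form_gradient_def)
qed

section \<open>The product inequality and its case of equality\<close>

lemma wiener_chaos_eq_range_hermite_form: "wiener_chaos k = range (hermite_form k)"
  unfolding wiener_chaos_eq_hermite hermite_chaos_def hermite_form_def[abs_def] multi_indices_def
  by auto

lemma fischer_norm2_pos:
  assumes "hermite_form k \<alpha> \<noteq> (\<lambda>x. 0)"
  shows "fischer_norm2 k \<alpha> > 0"
proof -
  have "\<exists>a\<in>multi_indices k. \<alpha> a \<noteq> 0"
    using assms by (auto simp: hermite_form_def[abs_def])
  then obtain a where a: "a \<in> multi_indices k" "\<alpha> a \<noteq> 0" by blast
  show ?thesis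
    unfolding fischer_norm2_def
    by (rule sum_pos2[OF _ a(1)]) (use a in \<open>auto intro: mult_nonneg_nonneg[OF less_imp_le[OF multi_fact_pos]]\<close>)
qed

theorem theorem1p1:
  fixes d :: nat and k :: "nat \<Rightarrow> nat" and F :: "nat \<Rightarrow> real ^ 'n \<Rightarrow> real"
  assumes "d \<ge> 1"
    and "\<And>i. i \<in> {1..d} \<Longrightarrow> k i \<ge> 1"
    and "\<And>i. i \<in> {1..d} \<Longrightarrow> F i \<in> wiener_chaos (k i)"
  shows "(\<integral>x. (\<Prod>i\<in>{1..d}. (F i x)\<^sup>2) \<partial>gauss_measure)
           \<ge> (\<Prod>i\<in>{1..d}. \<integral>x. (F i x)\<^sup>2 \<partial>gauss_measure)
       \<and> (prob_space.indep_vars gauss_measure (\<lambda>_. borel) F {1..d} \<longrightarrow>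
           (\<integral>x. (\<Prod>i\<in>{1..d}. (F i x)\<^sup>2) \<partial>gauss_measure)
             = (\<Prod>i\<in>{1..d}. \<integral>x. (F i x)\<^sup>2 \<partial>gauss_measure))
       \<and> ((\<integral>x. (\<Prod>i\<in>{1..d}. (F i x)\<^sup>2) \<partial>gauss_measure)
             = (\<Prod>i\<in>{1..d}. \<integral>x. (F i x)\<^sup>2 \<partial>gauss_measure)
           \<and> (d \<le> 2 \<or> (\<forall>i\<in>{1..d}. F i \<noteq> (\<lambda>x. 0)))
           \<longrightarrow> prob_space.indep_vars gauss_measure (\<lambda>_. borel) F {1..d})"
proof -
  interpret G: prob_space "gauss_measure :: (real ^ 'n) measure" by (rule prob_space_gauss_measure)
  let ?I = "{1..d}"
  have "\<exists>\<alpha>. F i = hermite_form (k i) \<alpha>" if "i \<in> ?I" for i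
    using assms(3)[OF that] by (auto simp: wiener_chaos_eq_range_hermite_form)
  then obtain \<alpha> where F: "\<And>i. i \<in> ?I \<Longrightarrow> F i = hermite_form (k i) (\<alpha> i)" by metis
  have poly: "real_polynomial_function (F i)" if "i \<in> ?I" for i
    using F[OF that] by (simp add: real_polynomial_function_hermite_form)
  have norm: "(\<integral>x. (F i x)\<^sup>2 \<partial>gauss_measure) = fischer_norm2 (k i) (\<alpha> i)" if "i \<in> ?I" for i
    using F[OF that] by (simp add: gauss_integral_hermite_form_square)
  have prod: "(\<integral>x. (\<Prod>i\<in>?I. (F i x)\<^sup>2) \<partial>gauss_measure)
      = (\<integral>x. (\<Prod>i\<in>?I. (hermite_form (k i) (\<alpha> i) x)\<^sup>2) \<partial>gauss_measure)"
    using F by (intro Bochner_Integration.integral_cong prod.cong) auto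
  have "(\<Prod>i\<in>?I. \<integral>x. (F i x)\<^sup>2 \<partial>gauss_measure) \<le> (\<integral>x. (\<Prod>i\<in>?I. (F i x)\<^sup>2) \<partial>gauss_measure)"
    \<comment> \<open>The empty product is the constant one, of norm one.\<close>
    using fischer_norm2_product_coeff_Un[of ?I "{}" k \<alpha>] fischer_norm2_product_coeff_le[of ?I k \<alpha>] norm
    unfolding prod
    by (simp add: multi_indices_0 product_coeff_empty fischer_norm2_def[of 0] multi_fact_def[of "\<lambda>_. 0"])
  moreover have "(\<integral>x. (\<Prod>i\<in>?I. (F i x)\<^sup>2) \<partial>gauss_measure) = (\<Prod>i\<in>?I. \<integral>x. (F i x)\<^sup>2 \<partial>gauss_measure)"
    if ind: "G.indep_vars (\<lambda>_. borel) F ?I"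
  proof (rule G.indep_vars_lebesgue_integral)
    show "G.indep_vars (\<lambda>_. borel) (\<lambda>i x. (F i x)\<^sup>2) ?I"
      by (rule G.indep_vars_compose2[OF ind]) simp
    show "integrable gauss_measure (\<lambda>x. (F i x)\<^sup>2)" if "i \<in> ?I" for i
      unfolding power2_eq_square
      by (intro gauss_integrable_polynomial real_polynomial_function_mult poly that)
  qed simp
  moreover have "G.indep_vars (\<lambda>_. borel) F ?I"
    if eq: "(\<integral>x. (\<Prod>i\<in>?I. (F i x)\<^sup>2) \<partial>gauss_measure) = (\<Prod>i\<in>?I. \<integral>x. (F i x)\<^sup>2 \<partial>gauss_measure)"
      and nz: "d \<le> 2 \<or> (\<forall>i\<in>?I. F i \<noteq> (\<lambda>x. 0))"
  proof -
    define V where "V i = span (form_gradient (\<alpha> i) ` multi_indices (k i - 1))" for i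
    have orth: "form_gradient (\<alpha> i) p \<bullet> form_gradient (\<alpha> j) s = 0"
      if ij: "i \<in> ?I" "j \<in> ?I" "i \<noteq> j" and "p \<in> multi_indices (k i - 1)" "s \<in> multi_indices (k j - 1)" for i j p s
    proof (rule product_equality_imp_orthogonal_gradients[of ?I, OF _ ij])
      show "(\<integral>x. (\<Prod>l\<in>?I. (hermite_form (k l) (\<alpha> l) x)\<^sup>2) \<partial>gauss_measure) \<le> (\<Prod>l\<in>?I. fischer_norm2 (k l) (\<alpha> l))"
        using eq norm unfolding prod by simp
      fix l assume l: "l \<in> ?I - {i, j}"
      \<comment> \<open>A third index exists only for \<open>d \<ge> 3\<close>, where all \<open>F l\<close> are assumed to be nonzero.\<close>
      have "\<not> d \<le> 2"
        using l ij by auto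
      with nz l F have "hermite_form (k l) (\<alpha> l) \<noteq> (\<lambda>x. 0)" by auto
      then show "fischer_norm2 (k l) (\<alpha> l) > 0" by (rule fischer_norm2_pos)
    qed (use assms(2) that in auto)
    show ?thesis
    proof (rule indep_vars_orthogonal_subspaces[where V = V])
      show "subspace (V i)" for i by (simp add: V_def)
      show "v \<bullet> w = 0" if ij: "i \<in> ?I" "j \<in> ?I" "i \<noteq> j" and v: "v \<in> V i" and w: "w \<in> V j" for i j v w
      proof -
        have yv: "orthogonal y v" if "y \<in> form_gradient (\<alpha> j) ` multi_indices (k j - 1)" for y
          using v unfolding V_def
          by (rule orthogonal_to_span) (use that orth ij in \<open>auto simp: orthogonal_def inner_commute\<close>)
        have "orthogonal v w"
          using w unfolding V_def
          by (rule orthogonal_to_span) (simp add: yv orthogonal_commute[of v])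
        then show ?thesis by (simp add: orthogonal_def)
      qed
      show "F i \<in> borel_measurable borel" if "i \<in> ?I" for i
        by (intro borel_measurable_continuous_onI continuous_at_imp_continuous_on ballI
            continuous_real_polymonial_function poly[OF that])
      show "F i (x + u) = F i x" if i: "i \<in> ?I" and u: "\<And>v. v \<in> V i \<Longrightarrow> u \<bullet> v = 0" for i x u
        unfolding F[OF i] using assms(2)[OF i]
        by (rule hermite_form_translate) (auto intro!: u span_base simp: V_def)
    qed
  qed
  ultimately show ?thesis by blast
qed

end
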